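(* Let $(H,\mathcal{R},\chi)$ be a pre-Cartier quasitriangular Hopf algebra with antipode $S$. Then $(S\otimes S)(\chi)=\mathcal{R}\chi\mathcal{R}^{-1}$ and $(S^2\otimes S^2)(\chi)=\chi$. As a consequence, a pre-Cartier quasitriangular Hopf algebra $(H,\mathcal{R},\chi)$ is Cartier if and only if $\tau(S\otimes S)(\chi)=\chi$, where $\tau:H\otimes H\to H\otimes H$ is the flip $a\otimes b\mapsto b\otimes a$.
   Context: Everything is over a field $\Bbbk$. For $T=\sum_i T^i\otimes T_i\in H\otimes H$ write $T_{12}=T\otimes 1$, $T_{23}=1\otimes T$, $T_{13}=\sum_i T^i\otimes 1\otimes T_i$, $T^{\mathrm{op}}=\sum_i T_i\otimes T^i$; $\Delta^{\mathrm{op}}=\tau\Delta$. A quasitriangular Hopf algebra $(H,\mathcal{R})$ is a Hopf algebra $H$ with an invertible $\mathcal{R}\in H\otimes H$ such that $\Delta^{\mathrm{op}}(h)=\mathcal{R}\Delta(h)\mathcal{R}^{-1}$ for all $h\in H$, $(\mathrm{Id}\otimes\Delta)(\mathcal{R})=\mathcal{R}_{13}\mathcal{R}_{12}$, $(\Delta\otimes\mathrm{Id})(\mathcal{R})=\mathcal{R}_{13}\mathcal{R}_{23}$. An infinitesimal $\mathcal{R}$-matrix for $(H,\mathcal{R})$ is $\chi\in H\otimes H$ such that $\chi\Delta(h)=\Delta(h)\chi$ for all $h$, $(\mathrm{Id}\otimes\Delta)(\chi)=\chi_{12}+\mathcal{R}_{12}^{-1}\chi_{13}\mathcal{R}_{12}$,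 and $(\Delta\otimes\mathrm{Id})(\chi)=\chi_{23}+\mathcal{R}_{23}^{-1}\chi_{13}\mathcal{R}_{23}$; then $(H,\mathcal{R},\chi)$ is called pre-Cartier. It is called Cartier if in addition $\mathcal{R}\chi=\chi^{\mathrm{op}}\mathcal{R}$. *)

theory Defs
  imports Complex_Main "HOL-Library.Poly_Mapping" "HOL-Algebra.Module"
begin

section \<open>Tensor powers of an algebra over a field\<close>

text \<open>
  An algebra over a field is given by a type \<open>'h\<close> of class \<open>ring_1\<close> together with a scalar
  multiplication \<open>s\<close> of a field \<open>'k\<close> on it. Its \<open>n\<close>-th tensor power is the free vector space
  on lists of length \<open>n\<close> modulo the subspace generated by the multilinearity relations;
  its elements are the equivalence classes, as sets of formal sums.
\<close>

type_synonym ('k, 'h) formal_sum = "'h list \<Rightarrow>\<^sub>0 'k"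
type_synonym ('k, 'h) tensor = "('k, 'h) formal_sum set"

definition formal_scale :: "'k::field \<Rightarrow> ('a \<Rightarrow>\<^sub>0 'k) \<Rightarrow> ('a \<Rightarrow>\<^sub>0 'k)"
  where "formal_scale c = Poly_Mapping.map ((*) c)"

definition formal_sums :: "nat \<Rightarrow> ('k::field, 'h) formal_sum set"
  where "formal_sums n = {p. \<forall>x \<in> Poly_Mapping.keys p. length x = n}"

definition multilinear_relations ::
    "('k::field \<Rightarrow> 'h::ring_1 \<Rightarrow> 'h) \<Rightarrow> nat \<Rightarrow> ('k, 'h) formal_sum set"
  where "multilinear_relations s n =
    {Poly_Mapping.single (x[i := a + b]) 1 - Poly_Mapping.single (x[i := a]) 1
        - Poly_Mapping.single (x[i := b]) 1 | x i a b. length x = n \<and> i < n} \<union>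
    {Poly_Mapping.single (x[i := s c a]) 1 - Poly_Mapping.single (x[i := a]) c
        | x i a c. length x = n \<and> i < n}"

definition tensor_rel ::
    "('k::field \<Rightarrow> 'h::ring_1 \<Rightarrow> 'h) \<Rightarrow> nat
      \<Rightarrow> (('k, 'h) formal_sum \<times> ('k, 'h) formal_sum) set"
  where "tensor_rel s n =
    {(p, q). p \<in> formal_sums n \<and> q \<in> formal_sums n \<and>
       p - q \<in> module.span formal_scale (multilinear_relations s n)}"

definition tensor_class ::
    "('k::field \<Rightarrow> 'h::ring_1 \<Rightarrow> 'h) \<Rightarrow> nat \<Rightarrow> ('k, 'h) formal_sum \<Rightarrow> ('k, 'h) tensor"
  where "tensor_class s n p = tensor_rel s n `` {p}"

definition tensor_rep :: "('k, 'h) tensor \<Rightarrow> ('k::field, 'h) formal_sum"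
  where "tensor_rep t = (SOME p. p \<in> t)"

definition pure ::
    "('k::field \<Rightarrow> 'h::ring_1 \<Rightarrow> 'h) \<Rightarrow> 'h list \<Rightarrow> ('k, 'h) tensor"
  where "pure s x = tensor_class s (length x) (Poly_Mapping.single x 1)"

text \<open>
  For a multilinear map \<open>f\<close>, given on lists of fixed length, the induced linear map on tensors:
  with values in a type with scalar multiplication \<open>sc\<close>, respectively in the \<open>n\<close>-th tensor power.
  For multilinear \<open>f\<close> the result does not depend on the chosen representative, and only for such
  \<open>f\<close> are these functions meaningful.
\<close>

definition lift ::
    "('k::field \<Rightarrow> 'b \<Rightarrow> 'b) \<Rightarrow> ('h list \<Rightarrow> 'b::comm_monoid_add) \<Rightarrow> ('k, 'h) tensor \<Rightarrow> 'b"
  where "lift sc f t =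
    (\<Sum>x \<in> Poly_Mapping.keys (tensor_rep t). sc (Poly_Mapping.lookup (tensor_rep t) x) (f x))"

definition lift_tensor ::
    "('k::field \<Rightarrow> 'h::ring_1 \<Rightarrow> 'h) \<Rightarrow> nat \<Rightarrow> ('h list \<Rightarrow> ('k, 'h) tensor)
      \<Rightarrow> ('k, 'h) tensor \<Rightarrow> ('k, 'h) tensor"
  where "lift_tensor s n f t = tensor_class s n (lift formal_scale (\<lambda>x. tensor_rep (f x)) t)"

text \<open>The algebra structure: \<open>(a\<^sub>1 \<otimes> \<dots> \<otimes> a\<^sub>n) (b\<^sub>1 \<otimes> \<dots> \<otimes> b\<^sub>n) = a\<^sub>1 b\<^sub>1 \<otimes> \<dots> \<otimes> a\<^sub>n b\<^sub>n\<close>.\<close>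

definition tensor_power ::
    "('k::field \<Rightarrow> 'h::ring_1 \<Rightarrow> 'h) \<Rightarrow> nat \<Rightarrow> ('k, ('k, 'h) tensor) module"
  where "tensor_power s n =
    \<lparr>carrier = formal_sums n // tensor_rel s n,
     mult = \<lambda>t u. lift_tensor s n (\<lambda>x. lift_tensor s n (\<lambda>y. pure s (map2 (*) x y)) u) t,
     one = pure s (replicate n 1),
     zero = tensor_class s n 0,
     add = \<lambda>t u. tensor_class s n (tensor_rep t + tensor_rep u),
     smult = \<lambda>c t. tensor_class s n (formal_scale c (tensor_rep t))\<rparr>"

definition lift2 ::
    "('k::field \<Rightarrow> 'b \<Rightarrow> 'b) \<Rightarrow> ('h \<Rightarrow> 'h \<Rightarrow> 'b::comm_monoid_add) \<Rightarrow> ('k, 'h) tensor \<Rightarrow> 'b"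
  where "lift2 sc f = lift sc (\<lambda>x. f (x ! 0) (x ! 1))"

definition lift2_tensor ::
    "('k::field \<Rightarrow> 'h::ring_1 \<Rightarrow> 'h) \<Rightarrow> nat \<Rightarrow> ('h \<Rightarrow> 'h \<Rightarrow> ('k, 'h) tensor)
      \<Rightarrow> ('k, 'h) tensor \<Rightarrow> ('k, 'h) tensor"
  where "lift2_tensor s n f = lift_tensor s n (\<lambda>x. f (x ! 0) (x ! 1))"

definition flip :: "('k::field \<Rightarrow> 'h::ring_1 \<Rightarrow> 'h) \<Rightarrow> ('k, 'h) tensor \<Rightarrow> ('k, 'h) tensor"
  where "flip s = lift2_tensor s 2 (\<lambda>a b. pure s [b, a])"

definition leg12 :: "('k::field \<Rightarrow> 'h::ring_1 \<Rightarrow> 'h) \<Rightarrow> ('k, 'h) tensor \<Rightarrow> ('k, 'h) tensor"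
  where "leg12 s = lift2_tensor s 3 (\<lambda>a b. pure s [a, b, 1])"

definition leg13 :: "('k::field \<Rightarrow> 'h::ring_1 \<Rightarrow> 'h) \<Rightarrow> ('k, 'h) tensor \<Rightarrow> ('k, 'h) tensor"
  where "leg13 s = lift2_tensor s 3 (\<lambda>a b. pure s [a, 1, b])"

definition leg23 :: "('k::field \<Rightarrow> 'h::ring_1 \<Rightarrow> 'h) \<Rightarrow> ('k, 'h) tensor \<Rightarrow> ('k, 'h) tensor"
  where "leg23 s = lift2_tensor s 3 (\<lambda>a b. pure s [1, a, b])"

text \<open>The map \<open>f \<otimes> g\<close> for linear endomorphisms \<open>f\<close>, \<open>g\<close>.\<close>

definition tensor_map ::
    "('k::field \<Rightarrow> 'h::ring_1 \<Rightarrow> 'h) \<Rightarrow> ('h \<Rightarrow> 'h) \<Rightarrow> ('h \<Rightarrow> 'h)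
      \<Rightarrow> ('k, 'h) tensor \<Rightarrow> ('k, 'h) tensor"
  where "tensor_map s f g = lift2_tensor s 2 (\<lambda>a b. pure s [f a, g b])"

text \<open>The maps \<open>\<Delta> \<otimes> Id\<close> and \<open>Id \<otimes> \<Delta>\<close> from the tensor square to the tensor cube.\<close>

definition comult_left ::
    "('k::field \<Rightarrow> 'h::ring_1 \<Rightarrow> 'h) \<Rightarrow> ('h \<Rightarrow> ('k, 'h) tensor)
      \<Rightarrow> ('k, 'h) tensor \<Rightarrow> ('k, 'h) tensor"
  where "comult_left s \<Delta> =
    lift2_tensor s 3 (\<lambda>a b. lift2_tensor s 3 (\<lambda>x y. pure s [x, y, b]) (\<Delta> a))"

definition comult_right ::
    "('k::field \<Rightarrow> 'h::ring_1 \<Rightarrow> 'h) \<Rightarrow> ('h \<Rightarrow> ('k, 'h) tensor)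
      \<Rightarrow> ('k, 'h) tensor \<Rightarrow> ('k, 'h) tensor"
  where "comult_right s \<Delta> =
    lift2_tensor s 3 (\<lambda>a b. lift2_tensor s 3 (\<lambda>x y. pure s [a, x, y]) (\<Delta> b))"


section \<open>Pre-Cartier quasitriangular Hopf algebras\<close>

locale algebra_over_field = vector_space s
  for s :: "'k::field \<Rightarrow> 'h::ring_1 \<Rightarrow> 'h" +
  assumes scale_mult_left: "s c (x * y) = s c x * y"
    and scale_mult_right: "s c (x * y) = x * s c y"
begin

abbreviation H2 where "H2 \<equiv> tensor_power s 2"
abbreviation H3 where "H3 \<equiv> tensor_power s 3"

end

locale bialgebra = algebra_over_field s
  for s :: "'k::field \<Rightarrow> 'h::ring_1 \<Rightarrow> 'h" +
  fixes \<Delta> :: "'h \<Rightarrow> ('k, 'h) tensor"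
    and \<epsilon> :: "'h \<Rightarrow> 'k"
  assumes comult_closed: "\<Delta> h \<in> carrier H2"
    and comult_add: "\<Delta> (g + h) = \<Delta> g \<oplus>\<^bsub>H2\<^esub> \<Delta> h"
    and comult_scale: "\<Delta> (s c h) = c \<odot>\<^bsub>H2\<^esub> \<Delta> h"
    and comult_mult: "\<Delta> (g * h) = \<Delta> g \<otimes>\<^bsub>H2\<^esub> \<Delta> h"
    and comult_one: "\<Delta> 1 = \<one>\<^bsub>H2\<^esub>"
    and counit_linear: "Vector_Spaces.linear s (*) \<epsilon>"
    and counit_mult: "\<epsilon> (g * h) = \<epsilon> g * \<epsilon> h"
    and counit_one: "\<epsilon> 1 = 1"
    and coassoc: "comult_left s \<Delta> (\<Delta> h) = comult_right s \<Delta> (\<Delta> h)"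
    and counit_left: "lift2 s (\<lambda>a b. s (\<epsilon> a) b) (\<Delta> h) = h"
    and counit_right: "lift2 s (\<lambda>a b. s (\<epsilon> b) a) (\<Delta> h) = h"

locale hopf_algebra = bialgebra s \<Delta> \<epsilon>
  for s :: "'k::field \<Rightarrow> 'h::ring_1 \<Rightarrow> 'h"
    and \<Delta> :: "'h \<Rightarrow> ('k, 'h) tensor"
    and \<epsilon> :: "'h \<Rightarrow> 'k" +
  fixes S :: "'h \<Rightarrow> 'h"
  assumes antipode_linear: "Vector_Spaces.linear s s S"
    and antipode_left: "lift2 s (\<lambda>a b. S a * b) (\<Delta> h) = s (\<epsilon> h) 1"
    and antipode_right: "lift2 s (\<lambda>a b. a * S b) (\<Delta> h) = s (\<epsilon> h) 1"

locale quasitriangular_hopf_algebra = hopf_algebra s \<Delta> \<epsilon> S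
  for s :: "'k::field \<Rightarrow> 'h::ring_1 \<Rightarrow> 'h"
    and \<Delta> :: "'h \<Rightarrow> ('k, 'h) tensor"
    and \<epsilon> :: "'h \<Rightarrow> 'k"
    and S :: "'h \<Rightarrow> 'h" +
  fixes R :: "('k, 'h) tensor"
  assumes R_invertible: "R \<in> Units H2"
    and R_comult: "flip s (\<Delta> h) = R \<otimes>\<^bsub>H2\<^esub> \<Delta> h \<otimes>\<^bsub>H2\<^esub> inv\<^bsub>H2\<^esub> R"
    and R_comult_right: "comult_right s \<Delta> R = leg13 s R \<otimes>\<^bsub>H3\<^esub> leg12 s R"
    and R_comult_left: "comult_left s \<Delta> R = leg13 s R \<otimes>\<^bsub>H3\<^esub> leg23 s R"

locale pre_cartier = quasitriangular_hopf_algebra s \<Delta> \<epsilon> S R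
  for s :: "'k::field \<Rightarrow> 'h::ring_1 \<Rightarrow> 'h"
    and \<Delta> :: "'h \<Rightarrow> ('k, 'h) tensor"
    and \<epsilon> :: "'h \<Rightarrow> 'k"
    and S :: "'h \<Rightarrow> 'h"
    and R :: "('k, 'h) tensor" +
  fixes \<chi> :: "('k, 'h) tensor"
  assumes chi_closed: "\<chi> \<in> carrier H2"
    and chi_comult: "\<chi> \<otimes>\<^bsub>H2\<^esub> \<Delta> h = \<Delta> h \<otimes>\<^bsub>H2\<^esub> \<chi>"
    and chi_comult_right: "comult_right s \<Delta> \<chi> =
      leg12 s \<chi> \<oplus>\<^bsub>H3\<^esub> inv\<^bsub>H3\<^esub> (leg12 s R) \<otimes>\<^bsub>H3\<^esub> leg13 s \<chi> \<otimes>\<^bsub>H3\<^esub> leg12 s R"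
    and chi_comult_left: "comult_left s \<Delta> \<chi> =
      leg23 s \<chi> \<oplus>\<^bsub>H3\<^esub> inv\<^bsub>H3\<^esub> (leg23 s R) \<otimes>\<^bsub>H3\<^esub> leg13 s \<chi> \<otimes>\<^bsub>H3\<^esub> leg23 s R"

locale cartier = pre_cartier s \<Delta> \<epsilon> S R \<chi>
  for s :: "'k::field \<Rightarrow> 'h::ring_1 \<Rightarrow> 'h"
    and \<Delta> :: "'h \<Rightarrow> ('k, 'h) tensor"
    and \<epsilon> :: "'h \<Rightarrow> 'k"
    and S :: "'h \<Rightarrow> 'h"
    and R :: "('k, 'h) tensor"
    and \<chi> :: "('k, 'h) tensor" +
  assumes R_chi: "R \<otimes>\<^bsub>H2\<^esub> \<chi> = flip s \<chi> \<otimes>\<^bsub>H2\<^esub> R"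

end

theory Submission
  imports Defs
begin

text \<open>
  Write \<open>\<chi> = \<Sum> \<chi>\<^sup>i \<otimes> \<chi>\<^sub>i\<close>, \<open>R = \<Sum> R\<^sup>j \<otimes> R\<^sub>j\<close> and \<open>R\<inverse> = \<Sum> r\<^sup>j \<otimes> r\<^sub>j\<close>. Applying a counit to
  the outer factor of the axioms for \<open>(Id \<otimes> \<Delta>)(\<chi>)\<close> and \<open>(\<Delta> \<otimes> Id)(\<chi>)\<close> gives
  \<open>(\<epsilon> \<otimes> Id)(\<chi>) = 0 = (Id \<otimes> \<epsilon>)(\<chi>)\<close>. Contracting the comultiplied factors with \<open>x S(y)\<close>,
  respectively \<open>S(x) y\<close>, then gives \<open>\<Sum> \<chi>\<^sup>i R\<^sup>j \<otimes> R\<^sub>j S(\<chi>\<^sub>i) = - R \<chi>\<close> and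
  \<open>\<Sum> S(\<chi>\<^sup>i) r\<^sup>j \<otimes> r\<^sub>j \<chi>\<^sub>i = - \<chi> R\<inverse>\<close>. Apply \<open>S \<otimes> Id\<close> to the former: since \<open>S\<close> reverses
  products and \<open>(S \<otimes> Id)(R) = R\<inverse>\<close>, it becomes \<open>R\<inverse> (S \<otimes> S)(\<chi>) = \<chi> R\<inverse>\<close> by the latter.
  A second application of \<open>S \<otimes> S\<close>, which fixes \<open>R\<inverse>\<close>, gives \<open>(S\<^sup>2 \<otimes> S\<^sup>2)(\<chi>) = \<chi>\<close>.

  Over a field, multilinear forms separate the points of a tensor power. All identities between
  tensors are therefore checked on scalars: \<open>ev2 t f\<close> is \<open>\<Sum> f(t\<^sup>i, t\<^sub>i)\<close>, operations on tensors
  become nested evaluations, and evaluations at different tensors commute because finite sums do.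
\<close>

text \<open>Adding \<open>v\<close> to a basis of \<open>span W\<close> keeps it independent, so
  values may be prescribed: 1 at \<open>v\<close> and 0 on the basis. It is used twice, to separate
  tensors (with \<open>W\<close> the multilinearity relations) and to separate vectors of the
  algebra (with \<open>W\<close> empty).\<close>

lemma (in vector_space) exists_linear_form_separating:
  assumes "v \<notin> span W"
  obtains \<phi> where "Vector_Spaces.linear scale (*) \<phi>" "\<And>w. w \<in> span W \<Longrightarrow> \<phi> w = 0" "\<phi> v = 1"
proof -
  interpret vs: vector_space "(*) :: 'a \<Rightarrow> 'a \<Rightarrow> 'a"
    by standard (simp_all add: algebra_simps)
  interpret pair: vector_space_pair scale "(*) :: 'a \<Rightarrow> 'a \<Rightarrow> 'a" ..
  obtain B where B: "B \<subseteq> span W" "independent B" "span W \<subseteq> span B"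
    using maximal_independent_subset[of "span W"] by blast
  then have span_B: "span B = span W"
    by (metis span_mono span_span subset_antisym)
  with B assms have "independent (insert v B)"
    by (simp add: independent_insertI)
  from pair.linear_independent_extend[OF this, of "\<lambda>x. if x = v then 1 else 0"]
  obtain \<phi> where \<phi>: "Vector_Spaces.linear scale (*) \<phi>"
      "\<forall>x \<in> insert v B. \<phi> x = (if x = v then 1 else 0)"
    by (elim exE conjE) (rule that)
  from \<phi>(1) interpret \<phi>: Vector_Spaces.linear scale "(*)" \<phi> .
  have "\<phi> w = 0" if "w \<in> span W" for w
    using that unfolding span_B[symmetric]
  proof (induction rule: span_induct_alt)
    case base
    show ?case by (rule \<phi>.zero)
  next
    case (step c x y)
    have "x \<noteq> v" using step B assms by auto
    with step \<phi>(2) show ?case by (simp add: \<phi>.add \<phi>.scale)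
  qed
  with \<phi> show ?thesis by (intro that[of \<phi>]) auto
qed

section \<open>Multilinear forms on tensor powers\<close>

lemma lookup_formal_scale: "Poly_Mapping.lookup (formal_scale c p) x = c * Poly_Mapping.lookup p x"
  by (simp add: formal_scale_def Poly_Mapping.map.rep_eq when_def)

lemma formal_scale_single:
  "formal_scale c (Poly_Mapping.single x a) = Poly_Mapping.single x (c * a)"
  by (rule poly_mapping_eqI) (simp add: lookup_formal_scale lookup_single when_def)

lemma vector_space_formal_scale: "vector_space (formal_scale :: 'k::field \<Rightarrow> ('a \<Rightarrow>\<^sub>0 'k) \<Rightarrow> _)"
  by standard (simp_all add: poly_mapping_eq_iff fun_eq_iff lookup_formal_scale lookup_add
      algebra_simps)

interpretation formal: vector_space "formal_scale :: 'k::field \<Rightarrow> ('a \<Rightarrow>\<^sub>0 'k) \<Rightarrow> _"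
  by (rule vector_space_formal_scale)

text \<open>The linear extension of \<open>g\<close> from basis elements to all formal sums.\<close>

definition formal_eval :: "('a \<Rightarrow> 'k::field) \<Rightarrow> ('a \<Rightarrow>\<^sub>0 'k) \<Rightarrow> 'k"
  where "formal_eval g p = (\<Sum>x \<in> Poly_Mapping.keys p. Poly_Mapping.lookup p x * g x)"

text \<open>Terms outside the support have coefficient 0. Sums for different \<open>p\<close> can
  thus be taken over one common index set and compared termwise.\<close>

lemma formal_eval_superset:
  assumes "finite A" "Poly_Mapping.keys p \<subseteq> A"
  shows "formal_eval g p = (\<Sum>x \<in> A. Poly_Mapping.lookup p x * g x)"
  unfolding formal_eval_def
  by (rule sum.mono_neutral_left) (use assms in \<open>auto simp: in_keys_iff\<close>)

lemma linear_formal_eval: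
  "Vector_Spaces.linear formal_scale (*) (formal_eval (g :: 'a \<Rightarrow> 'k::field))"
  unfolding Vector_Spaces.linear_iff
proof (intro conjI allI)
  show "vector_space ((*) :: 'k \<Rightarrow> 'k \<Rightarrow> 'k)"
    by standard (simp_all add: algebra_simps)
  fix p q :: "'a \<Rightarrow>\<^sub>0 'k" and c :: 'k
  let ?A = "Poly_Mapping.keys p \<union> Poly_Mapping.keys q"
  have "formal_eval g r = (\<Sum>x \<in> ?A. Poly_Mapping.lookup r x * g x)" if "r \<in> {p, q, p + q}" for r
    using that keys_add[of p q] by (intro formal_eval_superset) auto
  then show "formal_eval g (p + q) = formal_eval g p + formal_eval g q"
    by (simp add: lookup_add ring_distribs sum.distrib)
  have "Poly_Mapping.keys (formal_scale c p) \<subseteq> Poly_Mapping.keys p"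
    by (auto simp: in_keys_iff lookup_formal_scale)
  then show "formal_eval g (formal_scale c p) = c * formal_eval g p"
    by (simp add: formal_eval_superset[of "Poly_Mapping.keys p"] lookup_formal_scale
        sum_distrib_left mult.assoc)
qed (rule vector_space_formal_scale)

lemma formal_eval_single: "formal_eval g (Poly_Mapping.single x c) = c * g x"
  by (simp add: formal_eval_def)

lemmas formal_eval_simps =
  Vector_Spaces.linear.axioms(3)[OF linear_formal_eval, THEN module_hom.add]
  Vector_Spaces.linear.axioms(3)[OF linear_formal_eval, THEN module_hom.diff]
  Vector_Spaces.linear.axioms(3)[OF linear_formal_eval, THEN module_hom.sum]
  Vector_Spaces.linear.axioms(3)[OF linear_formal_eval, THEN module_hom.zero]
  Vector_Spaces.linear.axioms(3)[OF linear_formal_eval, THEN module_hom.scale]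
  formal_eval_single

lemma sum_single_lookup:
  "(\<Sum>x \<in> Poly_Mapping.keys p. Poly_Mapping.single x (Poly_Mapping.lookup p x)) = p"
  by (rule poly_mapping_eqI)
     (simp add: lookup_sum lookup_single when_def sum.delta' in_keys_iff eq_commute[of 0])

text \<open>A linear form is determined by its values on the basis. This turns an abstract
  separating form into the evaluation of a function on lists.\<close>

lemma formal_eval_linear_form:
  assumes "Vector_Spaces.linear formal_scale (*) \<phi>"
  shows "formal_eval (\<lambda>x. \<phi> (Poly_Mapping.single x 1)) p = \<phi> p"
proof -
  interpret Vector_Spaces.linear formal_scale "(*)" \<phi> by fact
  have "\<phi> p = \<phi> (\<Sum>x \<in> Poly_Mapping.keys p. Poly_Mapping.single x (Poly_Mapping.lookup p x))"
    by (simp add: sum_single_lookup)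
  also have "\<dots> = (\<Sum>x \<in> Poly_Mapping.keys p.
      \<phi> (formal_scale (Poly_Mapping.lookup p x) (Poly_Mapping.single x 1)))"
    by (simp add: sum formal_scale_single)
  finally show ?thesis by (simp add: scale formal_eval_def)
qed

lemma lift_eq_formal_eval: "lift (*) g t = formal_eval g (tensor_rep t)"
  by (simp add: lift_def formal_eval_def)

lemma formal_sums_add: "p \<in> formal_sums n \<Longrightarrow> q \<in> formal_sums n \<Longrightarrow> p + q \<in> formal_sums n"
  using keys_add[of p q] by (auto simp: formal_sums_def)

lemma formal_sums_zero: "0 \<in> formal_sums n"
  by (simp add: formal_sums_def)

lemma formal_sums_scale: "p \<in> formal_sums n \<Longrightarrow> formal_scale c p \<in> formal_sums n"
  by (auto simp: formal_sums_def in_keys_iff lookup_formal_scale)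

lemma formal_sums_sum: "(\<And>x. x \<in> A \<Longrightarrow> f x \<in> formal_sums n) \<Longrightarrow> sum f A \<in> formal_sums n"
  by (induction A rule: infinite_finite_induct) (auto intro: formal_sums_zero formal_sums_add)

section \<open>Multilinear forms descend to tensors and separate them\<close>

context algebra_over_field
begin

abbreviation linear_form :: "('h \<Rightarrow> 'k) \<Rightarrow> bool"
  where "linear_form \<equiv> Vector_Spaces.linear s (*)"

text \<open>Only lists of length \<open>n\<close> are tested, so the values of \<open>g\<close> on
  lists of any other length are unconstrained.\<close>

definition multilinear :: "nat \<Rightarrow> ('h list \<Rightarrow> 'k) \<Rightarrow> bool"
  where "multilinear n g \<longleftrightarrow> (\<forall>x i. length x = n \<longrightarrow> i < n \<longrightarrow> linear_form (\<lambda>a. g (x[i := a])))"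

abbreviation tensor_carrier :: "nat \<Rightarrow> ('k, 'h) tensor set"
  where "tensor_carrier n \<equiv> carrier (tensor_power s n)"

lemma tensor_carrier_eq: "tensor_carrier n = formal_sums n // tensor_rel s n"
  by (simp add: tensor_power_def)

lemma equiv_tensor_rel: "equiv (formal_sums n) (tensor_rel s n)"
proof (rule equivI)
  show "sym (tensor_rel s n)"
  proof (rule symI)
    fix p q assume "(p, q) \<in> tensor_rel s n"
    then show "(q, p) \<in> tensor_rel s n"
      using formal.span_neg[of "p - q" "multilinear_relations s n"] by (simp add: tensor_rel_def)
  qed
  show "trans (tensor_rel s n)"
  proof (rule transI)
    fix p q r assume "(p, q) \<in> tensor_rel s n" "(q, r) \<in> tensor_rel s n"
    then show "(p, r) \<in> tensor_rel s n"
      using formal.span_add[of "p - q" "multilinear_relations s n" "q - r"]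
      by (simp add: tensor_rel_def)
  qed
qed (auto simp: tensor_rel_def refl_on_def formal.span_zero)

lemma tensor_class_closed: "p \<in> formal_sums n \<Longrightarrow> tensor_class s n p \<in> tensor_carrier n"
  by (simp add: tensor_carrier_eq tensor_class_def quotientI)

lemma tensor_rep:
  assumes "t \<in> tensor_carrier n"
  shows tensor_rep_formal_sums: "tensor_rep t \<in> formal_sums n"
    and tensor_class_rep: "tensor_class s n (tensor_rep t) = t"
proof -
  obtain p where p: "p \<in> formal_sums n" "t = tensor_class s n p"
    using assms by (auto simp: tensor_carrier_eq tensor_class_def elim: quotientE)
  then have "p \<in> t"
    using equiv_class_self[OF equiv_tensor_rel, of p n] by (simp add: tensor_class_def)
  then have "tensor_rep t \<in> t"
    unfolding tensor_rep_def by (rule someI)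
  then have rel: "(p, tensor_rep t) \<in> tensor_rel s n"
    by (simp add: p tensor_class_def)
  then show "tensor_rep t \<in> formal_sums n"
    by (simp add: tensor_rel_def)
  from equiv_class_eq[OF equiv_tensor_rel rel] show "tensor_class s n (tensor_rep t) = t"
    unfolding p(2) by (simp add: tensor_class_def)
qed

text \<open>Each generator of the relations is an instance of additivity or homogeneity in one slot,
  so a form that is linear in that slot kills it.\<close>

lemma formal_eval_multilinear_relation:
  assumes "multilinear n g" "p \<in> formal.span (multilinear_relations s n)"
  shows "formal_eval g p = 0"
  using assms(2)
proof (induction rule: formal.span_induct_alt)
  case base
  show ?case by (simp add: formal_eval_simps)
next
  case (step c r q)
  have lin: "linear_form (\<lambda>a. g (x[i := a]))" if "length x = n" "i < n" for x i
    using assms(1) that by (simp add: multilinear_def)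
  have "formal_eval g r = 0"
    using step(1) unfolding multilinear_relations_def
  proof (elim UnE CollectE exE conjE)
    fix x i a b assume "length x = n" "i < n"
      and r: "r = Poly_Mapping.single (x[i := a + b]) 1 - Poly_Mapping.single (x[i := a]) 1
        - Poly_Mapping.single (x[i := b]) 1"
    then interpret Vector_Spaces.linear s "(*)" "\<lambda>a. g (x[i := a])" by (intro lin)
    show ?thesis by (simp add: r formal_eval_simps add)
  next
    fix x i a c assume "length x = n" "i < n"
      and r: "r = Poly_Mapping.single (x[i := s c a]) 1 - Poly_Mapping.single (x[i := a]) c"
    then interpret Vector_Spaces.linear s "(*)" "\<lambda>a. g (x[i := a])" by (intro lin)
    show ?thesis by (simp add: r formal_eval_simps scale)
  qed
  with step show ?case by (simp add: formal_eval_simps)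
qed

text \<open>The chosen representative differs from \<open>p\<close> by an element of the span of the
  relations, which a multilinear form does not see. This is the well-definedness of the induced
  map.\<close>

lemma lift_tensor_class:
  assumes "multilinear n g" "p \<in> formal_sums n"
  shows "lift (*) g (tensor_class s n p) = formal_eval g p"
proof -
  let ?t = "tensor_class s n p"
  have "?t \<in> tensor_carrier n"
    using assms(2) by (rule tensor_class_closed)
  then have "tensor_class s n (tensor_rep ?t) = ?t"
    by (rule tensor_class_rep)
  then have "(tensor_rep ?t, p) \<in> tensor_rel s n"
    using assms(2) eq_equiv_class[OF _ equiv_tensor_rel] by (simp add: tensor_class_def)
  then have "formal_eval g (tensor_rep ?t - p) = 0"
    using assms(1) by (intro formal_eval_multilinear_relation) (auto simp: tensor_rel_def)
  then show ?thesis by (simp add: lift_eq_formal_eval formal_eval_simps)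
qed

text \<open>If \<open>t\<close> and \<open>u\<close> differ, the difference of their representatives
  lies outside the span of the relations, and some linear form vanishes on that span but not on the
  difference.\<close>

lemma tensor_eqI:
  assumes t: "t \<in> tensor_carrier n" and u: "u \<in> tensor_carrier n"
    and eq: "\<And>g. multilinear n g \<Longrightarrow> lift (*) g t = lift (*) g u"
  shows "t = u"
proof (rule ccontr)
  assume "t \<noteq> u"
  let ?v = "tensor_rep t - tensor_rep u"
  have "?v \<notin> formal.span (multilinear_relations s n)"
  proof
    assume "?v \<in> formal.span (multilinear_relations s n)"
    then have "(tensor_rep t, tensor_rep u) \<in> tensor_rel s n"
      using t u by (simp add: tensor_rel_def tensor_rep_formal_sums)
    then have "tensor_class s n (tensor_rep t) = tensor_class s n (tensor_rep u)"
      using equiv_class_eq[OF equiv_tensor_rel] by (simp add: tensor_class_def)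
    with t u \<open>t \<noteq> u\<close> show False by (simp add: tensor_class_rep)
  qed
  then obtain \<phi> where \<phi>: "Vector_Spaces.linear formal_scale (*) \<phi>"
      "\<And>w. w \<in> formal.span (multilinear_relations s n) \<Longrightarrow> \<phi> w = 0" "\<phi> ?v = 1"
    by (rule formal.exists_linear_form_separating) blast
  interpret \<phi>: Vector_Spaces.linear formal_scale "(*)" \<phi> by (rule \<phi>(1))
  \<comment> \<open>The restriction of \<open>\<phi>\<close> to basis lists. Its multilinearity says
    exactly that \<open>\<phi>\<close> kills the two families of relations.\<close>
  let ?g = "\<lambda>x. \<phi> (Poly_Mapping.single x 1)"
  have rel: "\<phi> w = 0" if "w \<in> multilinear_relations s n" for w
    using \<phi>(2) that by (simp add: formal.span_base)
  have "multilinear n ?g"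
    unfolding multilinear_def Vector_Spaces.linear_iff
  proof (intro allI impI conjI)
    fix x :: "'h list" and i a b c assume x: "length x = n" "i < n"
    have "\<phi> (Poly_Mapping.single (x[i := a + b]) 1 - Poly_Mapping.single (x[i := a]) 1
        - Poly_Mapping.single (x[i := b]) 1) = 0"
      using x by (intro rel) (unfold multilinear_relations_def, blast)
    then show "?g (x[i := a + b]) = ?g (x[i := a]) + ?g (x[i := b])"
      by (simp add: \<phi>.diff \<phi>.add algebra_simps)
    have "\<phi> (Poly_Mapping.single (x[i := s c a]) 1 - Poly_Mapping.single (x[i := a]) c) = 0"
      using x by (intro rel) (unfold multilinear_relations_def, blast)
    then have "\<phi> (Poly_Mapping.single (x[i := s c a]) 1
        - formal_scale c (Poly_Mapping.single (x[i := a]) 1)) = 0"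
      by (simp add: formal_scale_single)
    then show "?g (x[i := s c a]) = c * ?g (x[i := a])"
      by (simp add: \<phi>.diff \<phi>.scale)
  qed (rule vector_space_axioms \<phi>.vs2.vector_space_axioms)+
  from eq[OF this] have "\<phi> ?v = 0"
    by (simp add: lift_eq_formal_eval formal_eval_linear_form[OF \<phi>(1)] \<phi>.diff)
  with \<phi>(3) show False by simp
qed

lemma lift_cong:
  assumes "t \<in> tensor_carrier n" "\<And>x. length x = n \<Longrightarrow> f x = g x"
  shows "lift (*) f t = lift (*) g t"
  using tensor_rep_formal_sums[OF assms(1)] assms(2)
  by (auto simp: lift_def formal_sums_def intro!: sum.cong)

lemma lift_tensor_closed:
  assumes "t \<in> tensor_carrier m" "\<And>x. length x = m \<Longrightarrow> f x \<in> tensor_carrier n"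
  shows "lift_tensor s n f t \<in> tensor_carrier n"
  unfolding lift_tensor_def lift_def
  using tensor_rep_formal_sums[OF assms(1)] assms(2)
  by (intro tensor_class_closed formal_sums_sum formal_sums_scale tensor_rep_formal_sums)
     (auto simp: formal_sums_def)

text \<open>Both sides expand the same chosen representative of \<open>t\<close>, so the identity
  reduces to linearity of \<open>formal_eval g\<close>.\<close>

lemma lift_lift_tensor:
  assumes "t \<in> tensor_carrier m" "\<And>x. length x = m \<Longrightarrow> f x \<in> tensor_carrier n" "multilinear n g"
  shows "lift (*) g (lift_tensor s n f t) = lift (*) (\<lambda>x. lift (*) g (f x)) t"
proof -
  have "lift formal_scale (\<lambda>x. tensor_rep (f x)) t \<in> formal_sums n"
    unfolding lift_def using tensor_rep_formal_sums[OF assms(1)] assms(2)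
    by (intro formal_sums_sum formal_sums_scale tensor_rep_formal_sums) (auto simp: formal_sums_def)
  then have "lift (*) g (lift_tensor s n f t)
      = formal_eval g (lift formal_scale (\<lambda>x. tensor_rep (f x)) t)"
    unfolding lift_tensor_def by (rule lift_tensor_class[OF assms(3)])
  then show ?thesis by (simp add: lift_def formal_eval_simps flip: formal_eval_def)
qed

lemma pure_closed: "length x = n \<Longrightarrow> pure s x \<in> tensor_carrier n"
  unfolding pure_def by (auto intro!: tensor_class_closed simp: formal_sums_def)

lemma lift_pure:
  assumes "multilinear (length x) g"
  shows "lift (*) g (pure s x) = g x"
  unfolding pure_def using assms
  by (subst lift_tensor_class) (auto simp: formal_sums_def formal_eval_simps)

lemma mult_closed:
  assumes "t \<in> tensor_carrier n" "u \<in> tensor_carrier n"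
  shows "t \<otimes>\<^bsub>tensor_power s n\<^esub> u \<in> tensor_carrier n"
  unfolding tensor_power_def[THEN arg_cong[where f = mult]] monoid.simps partial_object.simps
  by (intro lift_tensor_closed[OF assms(1)] lift_tensor_closed[OF assms(2)] pure_closed) simp

lemma lift_mult:
  assumes "t \<in> tensor_carrier n" "u \<in> tensor_carrier n" "multilinear n g"
  shows "lift (*) g (t \<otimes>\<^bsub>tensor_power s n\<^esub> u) = lift (*) (\<lambda>x. lift (*) (\<lambda>y. g (map2 (*) x y)) u) t"
proof -
  have "lift (*) g (t \<otimes>\<^bsub>tensor_power s n\<^esub> u)
      = lift (*) (\<lambda>x. lift (*) g (lift_tensor s n (\<lambda>y. pure s (map2 (*) x y)) u)) t"
    unfolding tensor_power_def[THEN arg_cong[where f = mult]] monoid.simps partial_object.simps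
    using assms by (intro lift_lift_tensor[OF assms(1)] lift_tensor_closed[OF assms(2)]
        pure_closed) simp_all
  also have "\<dots> = lift (*) (\<lambda>x. lift (*) (\<lambda>y. lift (*) g (pure s (map2 (*) x y))) u) t"
    using assms by (intro lift_cong[OF assms(1)] lift_lift_tensor[OF assms(2)] pure_closed) simp_all
  also have "\<dots> = lift (*) (\<lambda>x. lift (*) (\<lambda>y. g (map2 (*) x y)) u) t"
    using assms by (intro lift_cong[OF assms(1)] lift_cong[OF assms(2)] lift_pure) simp
  finally show ?thesis .
qed

lemma one_closed: "\<one>\<^bsub>tensor_power s n\<^esub> \<in> tensor_carrier n"
  by (auto simp: tensor_power_def[THEN arg_cong[where f = one]] intro!: pure_closed)

lemma lift_one: "multilinear n g \<Longrightarrow> lift (*) g \<one>\<^bsub>tensor_power s n\<^esub> = g (replicate n 1)"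
  by (auto simp: tensor_power_def[THEN arg_cong[where f = one]] intro!: lift_pure)

lemma lift_add:
  assumes "t \<in> tensor_carrier n" "u \<in> tensor_carrier n" "multilinear n g"
  shows "lift (*) g (t \<oplus>\<^bsub>tensor_power s n\<^esub> u) = lift (*) g t + lift (*) g u"
  using assms
  by (simp add: tensor_power_def[THEN arg_cong[where f = add]] lift_tensor_class
      formal_sums_add tensor_rep_formal_sums formal_eval_simps)
    (simp add: lift_eq_formal_eval)

lemma lift_smult:
  assumes "t \<in> tensor_carrier n" "multilinear n g"
  shows "lift (*) g (c \<odot>\<^bsub>tensor_power s n\<^esub> t) = c * lift (*) g t"
  using assms
  by (simp add: tensor_power_def[THEN arg_cong[where f = smult]] lift_tensor_class
      formal_sums_scale tensor_rep_formal_sums formal_eval_simps)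
    (simp add: lift_eq_formal_eval)

section \<open>Closure rules for linear forms and linear operators\<close>

abbreviation linear_op :: "('h \<Rightarrow> 'h) \<Rightarrow> bool"
  where "linear_op \<equiv> Vector_Spaces.linear s s"

lemma vector_space_field: "vector_space ((*) :: 'k \<Rightarrow> 'k \<Rightarrow> 'k)"
  by standard (simp_all add: algebra_simps)

lemma linear_formI:
  assumes "\<And>a b. \<phi> (a + b) = \<phi> a + \<phi> b" "\<And>c a. \<phi> (s c a) = c * \<phi> a"
  shows "linear_form \<phi>"
  using assms vector_space_axioms vector_space_field by (simp add: Vector_Spaces.linear_iff)

lemma linear_opI:
  assumes "\<And>a b. L (a + b) = L a + L b" "\<And>c a. L (s c a) = s c (L a)"
  shows "linear_op L"
  using assms vector_space_axioms by (simp add: Vector_Spaces.linear_iff)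

lemma linear_formD:
  assumes "linear_form \<phi>"
  shows "\<phi> (a + b) = \<phi> a + \<phi> b" "\<phi> (s c a) = c * \<phi> a"
  using assms by (simp_all add: Vector_Spaces.linear_iff)

lemma linear_opD:
  assumes "linear_op L"
  shows "L (a + b) = L a + L b" "L (s c a) = s c (L a)"
  using assms by (simp_all add: Vector_Spaces.linear_iff)

lemma linear_form_compose: "linear_form \<phi> \<Longrightarrow> linear_op L \<Longrightarrow> linear_form (\<lambda>x. \<phi> (L x))"
  by (intro linear_formI) (simp_all add: linear_formD linear_opD)

lemma linear_op_compose: "linear_op M \<Longrightarrow> linear_op L \<Longrightarrow> linear_op (\<lambda>x. M (L x))"
  by (intro linear_opI) (simp_all add: linear_opD)

lemma linear_op_intros:
  "linear_op (\<lambda>x. x)"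
  "linear_op L \<Longrightarrow> linear_op (\<lambda>x. a * L x)"
  "linear_op L \<Longrightarrow> linear_op (\<lambda>x. L x * a)"
  by (auto intro!: linear_opI simp: linear_opD distrib_left distrib_right
      scale_mult_left[symmetric] scale_mult_right[symmetric])

lemma linear_form_mult_const:
  "linear_form \<phi> \<Longrightarrow> linear_form (\<lambda>x. c * \<phi> x)"
  "linear_form \<phi> \<Longrightarrow> linear_form (\<lambda>x. \<phi> x * c)"
  by (auto intro!: linear_formI simp: linear_formD algebra_simps)

text \<open>For fixed \<open>t\<close> the evaluation is a finite combination of the forms, with
  coefficients that do not depend on \<open>x\<close>.\<close>

lemma linear_form_lift:
  assumes "\<And>y. linear_form (\<lambda>x. g x y)"
  shows "linear_form (\<lambda>x. lift (*) (g x) t)"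
  by (rule linear_formI)
     (simp_all add: lift_def linear_formD[OF assms] ring_distribs sum.distrib sum_distrib_left
       mult.left_commute)

text \<open>Linear forms separate vectors: this is separation from the zero subspace, applied to
  \<open>x - y\<close>. It reduces identities in the algebra, such as those for the antipode, to
  scalars.\<close>

lemma eqI_linear_form:
  assumes "\<And>\<phi>. linear_form \<phi> \<Longrightarrow> \<phi> x = \<phi> y"
  shows "x = y"
proof (rule ccontr)
  assume "x \<noteq> y"
  then have "x - y \<notin> span {}"
    by simp
  then obtain \<phi> where \<phi>: "linear_form \<phi>" "\<phi> (x - y) = 1"
    by (rule exists_linear_form_separating)
  have "\<phi> x = \<phi> (x - y) + \<phi> y"
    using linear_formD(1)[OF \<phi>(1), of "x - y" y] by simp
  with \<phi>(2) assms[OF \<phi>(1)] show False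
    by simp
qed

section \<open>Tensor powers as monoids\<close>

lemma multilinear_lift:
  assumes "u \<in> tensor_carrier n" "\<And>y. length y = n \<Longrightarrow> multilinear n (\<lambda>x. g x y)"
  shows "multilinear n (\<lambda>x. lift (*) (g x) u)"
  unfolding multilinear_def
proof (intro allI impI)
  fix x :: "'h list" and i assume x: "length x = n" "i < n"
  \<comment> \<open>\<open>linear_form_lift\<close> wants linearity for every list \<open>y\<close>,
    but it is known only for those of length \<open>n\<close>. The default value 0 supplies the
    rest, and evaluation at \<open>u\<close> meets only lists of length \<open>n\<close>.\<close>
  let ?g = "\<lambda>x y. if length y = n then g x y else 0"
  have "linear_form (\<lambda>a. ?g (x[i := a]) y)" for y
    using x assms(2)[of y]
    by (cases "length y = n") (auto simp: multilinear_def intro: linear_formI)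
  then have "linear_form (\<lambda>a. lift (*) (?g (x[i := a])) u)"
    by (rule linear_form_lift)
  moreover have "lift (*) (?g x) u = lift (*) (g x) u" for x
    by (rule lift_cong[OF assms(1)]) simp
  ultimately show "linear_form (\<lambda>a. lift (*) (g (x[i := a])) u)"
    by simp
qed

lemma multilinear_map2_left:
  assumes "multilinear n g" "length y = n"
  shows "multilinear n (\<lambda>x. g (map2 (*) x y))"
  unfolding multilinear_def
proof (intro allI impI)
  fix x :: "'h list" and i assume x: "length x = n" "i < n"
  \<comment> \<open>Replacing a slot commutes with entrywise multiplication up to a factor, so
    linearity in the slot is linearity of \<open>g\<close> after right multiplication by
    \<open>y ! i\<close>.\<close>
  have "map2 (*) (x[i := a]) y = (map2 (*) x y)[i := a * y ! i]" for a
    using x assms(2) by (intro nth_equalityI) (auto simp: nth_list_update)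
  moreover have "linear_form (\<lambda>a. g ((map2 (*) x y)[i := a * y ! i]))"
    using x assms
    by (intro linear_form_compose[of "\<lambda>a. g ((map2 (*) x y)[i := a])", OF _ linear_op_intros(3)]
        linear_op_intros(1))
      (auto simp: multilinear_def)
  ultimately show "linear_form (\<lambda>a. g (map2 (*) (x[i := a]) y))"
    by simp
qed

lemma multilinear_map2_right:
  assumes "multilinear n g" "length y = n"
  shows "multilinear n (\<lambda>x. g (map2 (*) y x))"
  unfolding multilinear_def
proof (intro allI impI)
  fix x :: "'h list" and i assume x: "length x = n" "i < n"
  have "map2 (*) y (x[i := a]) = (map2 (*) y x)[i := y ! i * a]" for a
    using x assms(2) by (intro nth_equalityI) (auto simp: nth_list_update)
  moreover have "linear_form (\<lambda>a. g ((map2 (*) y x)[i := y ! i * a]))"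
    using x assms
    by (intro linear_form_compose[of "\<lambda>a. g ((map2 (*) y x)[i := a])", OF _ linear_op_intros(2)]
        linear_op_intros(1))
      (auto simp: multilinear_def)
  ultimately show "linear_form (\<lambda>a. g (map2 (*) y (x[i := a])))"
    by simp
qed

lemmas multilinear_map2 = multilinear_map2_left multilinear_map2_right

lemma map2_mult_assoc:
  "length x = n \<Longrightarrow> length y = n \<Longrightarrow> length z = n \<Longrightarrow>
    map2 (*) (map2 (*) x y) z = map2 (*) x (map2 (*) y (z :: 'h list))"
  by (rule nth_equalityI) (simp_all add: mult.assoc)

lemma map2_mult_one:
  "length x = n \<Longrightarrow> map2 (*) (replicate n 1) x = (x :: 'h list)"
  "length x = n \<Longrightarrow> map2 (*) x (replicate n 1) = (x :: 'h list)"
  by (rule nth_equalityI; simp)+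

lemma monoid_tensor_power: "monoid (tensor_power s n)"
proof (rule monoidI)
  fix t u v assume tuv: "t \<in> tensor_carrier n" "u \<in> tensor_carrier n" "v \<in> tensor_carrier n"
  show "t \<otimes>\<^bsub>tensor_power s n\<^esub> u \<otimes>\<^bsub>tensor_power s n\<^esub> v
      = t \<otimes>\<^bsub>tensor_power s n\<^esub> (u \<otimes>\<^bsub>tensor_power s n\<^esub> v)"
  proof (rule tensor_eqI[of _ n])
    fix g assume g: "multilinear n g"
    \<comment> \<open>The outer product can be expanded only against a multilinear form; here that
      form is the one left over after expanding the factor \<open>v\<close>.\<close>
    have "multilinear n (\<lambda>x. lift (*) (\<lambda>y. g (map2 (*) x y)) v)"
      using g by (intro multilinear_lift[OF tuv(3)] multilinear_map2)
    with g tuv have "lift (*) g (t \<otimes>\<^bsub>tensor_power s n\<^esub> u \<otimes>\<^bsub>tensor_power s n\<^esub> v)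
        = lift (*) (\<lambda>x. lift (*) (\<lambda>y. lift (*) (\<lambda>z. g (map2 (*) (map2 (*) x y) z)) v) u) t"
      by (simp add: lift_mult mult_closed)
    also have "\<dots> = lift (*) (\<lambda>x. lift (*) (\<lambda>y. lift (*) (\<lambda>z. g (map2 (*) x (map2 (*) y z))) v) u) t"
      by (intro lift_cong[OF tuv(1)] lift_cong[OF tuv(2)] lift_cong[OF tuv(3)])
         (simp add: map2_mult_assoc)
    also have "\<dots> = lift (*) (\<lambda>x. lift (*) (\<lambda>w. g (map2 (*) x w)) (u \<otimes>\<^bsub>tensor_power s n\<^esub> v)) t"
      using g by (intro lift_cong[OF tuv(1)] lift_mult[OF tuv(2,3), symmetric] multilinear_map2)
    also have "\<dots> = lift (*) g (t \<otimes>\<^bsub>tensor_power s n\<^esub> (u \<otimes>\<^bsub>tensor_power s n\<^esub> v))"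
      using g tuv by (simp add: lift_mult mult_closed)
    finally show "lift (*) g (t \<otimes>\<^bsub>tensor_power s n\<^esub> u \<otimes>\<^bsub>tensor_power s n\<^esub> v)
        = lift (*) g (t \<otimes>\<^bsub>tensor_power s n\<^esub> (u \<otimes>\<^bsub>tensor_power s n\<^esub> v))" .
  qed (use tuv in \<open>simp_all add: mult_closed\<close>)
next
  fix t assume t: "t \<in> tensor_carrier n"
  show "\<one>\<^bsub>tensor_power s n\<^esub> \<otimes>\<^bsub>tensor_power s n\<^esub> t = t"
  proof (rule tensor_eqI[of _ n])
    fix g assume g: "multilinear n g"
    have "multilinear n (\<lambda>x. lift (*) (\<lambda>y. g (map2 (*) x y)) t)"
      using g by (intro multilinear_lift[OF t] multilinear_map2)
    with g t have "lift (*) g (\<one>\<^bsub>tensor_power s n\<^esub> \<otimes>\<^bsub>tensor_power s n\<^esub> t)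
        = lift (*) (\<lambda>y. g (map2 (*) (replicate n 1) y)) t"
      by (simp add: lift_mult lift_one one_closed)
    also have "\<dots> = lift (*) g t"
      by (rule lift_cong[OF t]) (simp add: map2_mult_one)
    finally show "lift (*) g (\<one>\<^bsub>tensor_power s n\<^esub> \<otimes>\<^bsub>tensor_power s n\<^esub> t) = lift (*) g t" .
  qed (use t in \<open>simp_all add: mult_closed one_closed\<close>)
  show "t \<otimes>\<^bsub>tensor_power s n\<^esub> \<one>\<^bsub>tensor_power s n\<^esub> = t"
  proof (rule tensor_eqI[of _ n])
    fix g assume g: "multilinear n g"
    with t have "lift (*) g (t \<otimes>\<^bsub>tensor_power s n\<^esub> \<one>\<^bsub>tensor_power s n\<^esub>)
        = lift (*) (\<lambda>x. lift (*) (\<lambda>y. g (map2 (*) x y)) \<one>\<^bsub>tensor_power s n\<^esub>) t"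
      by (simp add: lift_mult one_closed)
    also have "\<dots> = lift (*) g t"
      using g by (intro lift_cong[OF t]) (simp add: lift_one multilinear_map2 map2_mult_one)
    finally show "lift (*) g (t \<otimes>\<^bsub>tensor_power s n\<^esub> \<one>\<^bsub>tensor_power s n\<^esub>) = lift (*) g t" .
  qed (use t in \<open>simp_all add: mult_closed one_closed\<close>)
qed (auto intro: mult_closed one_closed)

end

sublocale algebra_over_field \<subseteq> H2: monoid H2 + H3: monoid H3
  by (rule monoid_tensor_power)+

section \<open>Bilinear and trilinear forms\<close>

context algebra_over_field
begin

definition bilinear :: "('h \<Rightarrow> 'h \<Rightarrow> 'k) \<Rightarrow> bool"
  where "bilinear f \<longleftrightarrow> (\<forall>b. linear_form (\<lambda>a. f a b)) \<and> (\<forall>a. linear_form (\<lambda>b. f a b))"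

definition trilinear :: "('h \<Rightarrow> 'h \<Rightarrow> 'h \<Rightarrow> 'k) \<Rightarrow> bool"
  where "trilinear f \<longleftrightarrow> (\<forall>b c. linear_form (\<lambda>a. f a b c)) \<and> (\<forall>a c. linear_form (\<lambda>b. f a b c))
    \<and> (\<forall>a b. linear_form (\<lambda>c. f a b c))"

definition ev2 :: "('k, 'h) tensor \<Rightarrow> ('h \<Rightarrow> 'h \<Rightarrow> 'k) \<Rightarrow> 'k"
  where "ev2 t f = lift2 (*) f t"

definition ev3 :: "('k, 'h) tensor \<Rightarrow> ('h \<Rightarrow> 'h \<Rightarrow> 'h \<Rightarrow> 'k) \<Rightarrow> 'k"
  where "ev3 t f = lift (*) (\<lambda>x. f (x ! 0) (x ! 1) (x ! 2)) t"

lemma bilinearI: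
  assumes "\<And>b. linear_form (\<lambda>a. f a b)" "\<And>a. linear_form (\<lambda>b. f a b)"
  shows "bilinear f"
  using assms by (simp add: bilinear_def)

lemma trilinearI:
  assumes "\<And>b c. linear_form (\<lambda>a. f a b c)" "\<And>a c. linear_form (\<lambda>b. f a b c)"
    "\<And>a b. linear_form (\<lambda>c. f a b c)"
  shows "trilinear f"
  using assms by (simp add: trilinear_def)

lemma linear_form_bilinear:
  assumes "bilinear f"
  shows "linear_op L \<Longrightarrow> linear_form (\<lambda>x. f (L x) b)"
    and "linear_op L \<Longrightarrow> linear_form (\<lambda>x. f a (L x))"
  using assms by (auto simp: bilinear_def intro: linear_form_compose[of "\<lambda>a. f a b"]
      linear_form_compose[of "f a"])

lemma linear_form_trilinear:
  assumes "trilinear f"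
  shows "linear_op L \<Longrightarrow> linear_form (\<lambda>x. f (L x) b c)"
    and "linear_op L \<Longrightarrow> linear_form (\<lambda>x. f a (L x) c)"
    and "linear_op L \<Longrightarrow> linear_form (\<lambda>x. f a b (L x))"
  using assms by (auto simp: trilinear_def intro: linear_form_compose[of "\<lambda>a. f a b c"]
      linear_form_compose[of "\<lambda>b. f a b c"] linear_form_compose[of "f a b"])

lemma linear_form_ev2:
  assumes "\<And>a b. linear_form (\<lambda>x. g x a b)"
  shows "linear_form (\<lambda>x. ev2 t (\<lambda>a b. g x a b))"
  unfolding ev2_def lift2_def using assms by (rule linear_form_lift)

lemmas linear_intros = bilinearI trilinearI linear_form_ev2 linear_op_intros

lemma ev2_const_mult: "ev2 t (\<lambda>a b. c * f a b) = c * ev2 t f"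
  by (simp add: ev2_def lift2_def lift_def sum_distrib_left mult.left_commute)

lemma ev2_commute: "ev2 t (\<lambda>a b. ev2 u (\<lambda>c d. f a b c d)) = ev2 u (\<lambda>c d. ev2 t (\<lambda>a b. f a b c d))"
  unfolding ev2_def lift2_def lift_def sum_distrib_left
  by (subst sum.swap) (simp add: mult.left_commute)

text \<open>This converts axioms with values in the algebra, such as those of the counit and the
  antipode, into identities of scalars.\<close>

lemma linear_form_lift2:
  assumes "linear_form \<phi>"
  shows "\<phi> (lift2 s f t) = ev2 t (\<lambda>a b. \<phi> (f a b))"
proof -
  interpret Vector_Spaces.linear s "(*)" \<phi> by fact
  show ?thesis by (simp add: ev2_def lift2_def lift_def sum scale)
qed

lemma multilinear_bilinear:
  assumes "bilinear f"
  shows "multilinear 2 (\<lambda>x. f (x ! 0) (x ! 1))"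
  using assms by (auto simp: multilinear_def bilinear_def less_2_cases_iff)

lemma bilinear_multilinear:
  assumes "multilinear 2 g"
  shows "bilinear (\<lambda>a b. g [a, b])"
proof (rule bilinearI)
  fix a b
  show "linear_form (\<lambda>a. g [a, b])" "linear_form (\<lambda>b. g [a, b])"
    using assms[unfolded multilinear_def, rule_format, of "[a, b]" 0]
      assms[unfolded multilinear_def, rule_format, of "[a, b]" 1] by simp_all
qed

lemma multilinear_trilinear:
  assumes "trilinear f"
  shows "multilinear 3 (\<lambda>x. f (x ! 0) (x ! 1) (x ! 2))"
  using assms
  by (auto simp: multilinear_def trilinear_def numeral_3_eq_3 numeral_2_eq_2 less_Suc_eq)

lemma trilinear_multilinear:
  assumes "multilinear 3 g"
  shows "trilinear (\<lambda>a b c. g [a, b, c])"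
proof (rule trilinearI)
  fix a b c
  show "linear_form (\<lambda>a. g [a, b, c])" "linear_form (\<lambda>b. g [a, b, c])"
    "linear_form (\<lambda>c. g [a, b, c])"
    using assms[unfolded multilinear_def, rule_format, of "[a, b, c]" 0]
      assms[unfolded multilinear_def, rule_format, of "[a, b, c]" 1]
      assms[unfolded multilinear_def, rule_format, of "[a, b, c]" 2] by simp_all
qed

lemma length_2_nth: "length x = 2 \<Longrightarrow> [x ! 0, x ! 1] = x"
  by (auto simp: numeral_2_eq_2 length_Suc_conv)

lemma length_3_nth: "length x = 3 \<Longrightarrow> [x ! 0, x ! 1, x ! 2] = x"
  by (auto simp: numeral_3_eq_3 numeral_2_eq_2 length_Suc_conv)

lemma ev2_cong: "(\<And>a b. f a b = g a b) \<Longrightarrow> ev2 t f = ev2 t g"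
  by (rule arg_cong[of f g]) (intro ext)

lemma tensor2_eqI:
  assumes "t \<in> carrier H2" "u \<in> carrier H2" "\<And>f. bilinear f \<Longrightarrow> ev2 t f = ev2 u f"
  shows "t = u"
proof (rule tensor_eqI[OF assms(1,2)])
  fix g :: "'h list \<Rightarrow> 'k" assume "multilinear 2 g"
  then have "ev2 t (\<lambda>a b. g [a, b]) = ev2 u (\<lambda>a b. g [a, b])"
    by (intro assms bilinear_multilinear)
  moreover have "ev2 v (\<lambda>a b. g [a, b]) = lift (*) g v" if "v \<in> carrier H2" for v
    unfolding ev2_def lift2_def using that
    by (intro lift_cong) (auto intro: arg_cong[of _ _ g] length_2_nth simp del: One_nat_def)
  ultimately show "lift (*) g t = lift (*) g u"
    using assms by simp
qed

lemma tensor3_eqI: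
  assumes "t \<in> carrier H3" "u \<in> carrier H3" "\<And>f. trilinear f \<Longrightarrow> ev3 t f = ev3 u f"
  shows "t = u"
proof (rule tensor_eqI[OF assms(1,2)])
  fix g :: "'h list \<Rightarrow> 'k" assume "multilinear 3 g"
  then have "ev3 t (\<lambda>a b c. g [a, b, c]) = ev3 u (\<lambda>a b c. g [a, b, c])"
    by (intro assms trilinear_multilinear)
  moreover have "ev3 v (\<lambda>a b c. g [a, b, c]) = lift (*) g v" if "v \<in> carrier H3" for v
    unfolding ev3_def using that
    by (intro lift_cong) (auto intro: arg_cong[of _ _ g] length_3_nth simp del: One_nat_def)
  ultimately show "lift (*) g t = lift (*) g u"
    using assms by simp
qed

section \<open>Evaluation of products, sums, legs and flips\<close>

lemma ev2_mult:
  assumes "t \<in> carrier H2" "u \<in> carrier H2" "bilinear f"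
  shows "ev2 (t \<otimes>\<^bsub>H2\<^esub> u) f = ev2 t (\<lambda>a b. ev2 u (\<lambda>c d. f (a * c) (b * d)))"
  unfolding ev2_def lift2_def lift_mult[OF assms(1,2) multilinear_bilinear[OF assms(3)]]
  by (intro lift_cong[OF assms(1)] lift_cong[OF assms(2)]) simp

lemma ev3_mult:
  assumes "t \<in> carrier H3" "u \<in> carrier H3" "trilinear f"
  shows "ev3 (t \<otimes>\<^bsub>H3\<^esub> u) f = ev3 t (\<lambda>a b c. ev3 u (\<lambda>a' b' c'. f (a * a') (b * b') (c * c')))"
  unfolding ev3_def lift_mult[OF assms(1,2) multilinear_trilinear[OF assms(3)]]
  by (intro lift_cong[OF assms(1)] lift_cong[OF assms(2)]) simp

lemma ev2_one: "bilinear f \<Longrightarrow> ev2 \<one>\<^bsub>H2\<^esub> f = f 1 1"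
  by (simp add: ev2_def lift2_def lift_one[OF multilinear_bilinear] del: One_nat_def)

lemma ev3_one: "trilinear f \<Longrightarrow> ev3 \<one>\<^bsub>H3\<^esub> f = f 1 1 1"
  by (simp add: ev3_def lift_one[OF multilinear_trilinear] del: One_nat_def)

lemma ev2_add:
  assumes "t \<in> carrier H2" "u \<in> carrier H2" "bilinear f"
  shows "ev2 (t \<oplus>\<^bsub>H2\<^esub> u) f = ev2 t f + ev2 u f"
  unfolding ev2_def lift2_def by (rule lift_add[OF assms(1,2) multilinear_bilinear[OF assms(3)]])

lemma ev3_add:
  assumes "t \<in> carrier H3" "u \<in> carrier H3" "trilinear f"
  shows "ev3 (t \<oplus>\<^bsub>H3\<^esub> u) f = ev3 t f + ev3 u f"
  unfolding ev3_def by (rule lift_add[OF assms(1,2) multilinear_trilinear[OF assms(3)]])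

lemma ev2_smult:
  assumes "t \<in> carrier H2" "bilinear f"
  shows "ev2 (c \<odot>\<^bsub>H2\<^esub> t) f = c * ev2 t f"
  unfolding ev2_def lift2_def by (rule lift_smult[OF assms(1) multilinear_bilinear[OF assms(2)]])

lemma lift2_tensor_closed:
  assumes "t \<in> carrier H2" "\<And>a b. f a b \<in> tensor_carrier n"
  shows "lift2_tensor s n f t \<in> tensor_carrier n"
  unfolding lift2_tensor_def using assms by (intro lift_tensor_closed)

lemma ev2_lift2_tensor:
  assumes "t \<in> carrier H2" "\<And>a b. f a b \<in> carrier H2" "bilinear g"
  shows "ev2 (lift2_tensor s 2 f t) g = ev2 t (\<lambda>a b. ev2 (f a b) g)"
  unfolding ev2_def lift2_def lift2_tensor_def
  using assms by (intro lift_lift_tensor multilinear_bilinear)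

lemma ev3_lift2_tensor:
  assumes "t \<in> carrier H2" "\<And>a b. f a b \<in> carrier H3" "trilinear g"
  shows "ev3 (lift2_tensor s 3 f t) g = ev2 t (\<lambda>a b. ev3 (f a b) g)"
  unfolding ev3_def ev2_def lift2_def lift2_tensor_def
  using assms by (intro lift_lift_tensor multilinear_trilinear)

lemma pure2_closed: "pure s [a, b] \<in> carrier H2"
  by (rule pure_closed) simp

lemma pure3_closed: "pure s [a, b, c] \<in> carrier H3"
  by (rule pure_closed) simp

lemma ev2_pure: "bilinear f \<Longrightarrow> ev2 (pure s [a, b]) f = f a b"
  unfolding ev2_def lift2_def
  by (subst lift_pure) (use multilinear_bilinear[of f] in \<open>simp_all add: numeral_2_eq_2\<close>)

lemma ev3_pure: "trilinear f \<Longrightarrow> ev3 (pure s [a, b, c]) f = f a b c"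
  unfolding ev3_def
  by (subst lift_pure) (use multilinear_trilinear[of f] in \<open>simp_all add: numeral_3_eq_3 numeral_2_eq_2\<close>)

lemma leg_closed:
  assumes "t \<in> carrier H2"
  shows "leg12 s t \<in> carrier H3" "leg13 s t \<in> carrier H3" "leg23 s t \<in> carrier H3"
  unfolding leg12_def leg13_def leg23_def by (intro lift2_tensor_closed assms pure3_closed)+

lemma ev3_leg:
  assumes "t \<in> carrier H2" "trilinear f"
  shows "ev3 (leg12 s t) f = ev2 t (\<lambda>a b. f a b 1)"
    and "ev3 (leg13 s t) f = ev2 t (\<lambda>a b. f a 1 b)"
    and "ev3 (leg23 s t) f = ev2 t (\<lambda>a b. f 1 a b)"
  unfolding leg12_def leg13_def leg23_def
  using assms by (simp_all add: ev3_lift2_tensor pure3_closed ev3_pure)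

lemma flip_closed: "t \<in> carrier H2 \<Longrightarrow> flip s t \<in> carrier H2"
  unfolding flip_def by (intro lift2_tensor_closed pure2_closed)

lemma ev2_flip: "t \<in> carrier H2 \<Longrightarrow> bilinear f \<Longrightarrow> ev2 (flip s t) f = ev2 t (\<lambda>a b. f b a)"
  unfolding flip_def by (simp add: ev2_lift2_tensor pure2_closed ev2_pure)

lemma flip_flip:
  assumes "t \<in> carrier H2"
  shows "flip s (flip s t) = t"
proof (intro tensor2_eqI flip_closed assms)
  fix f assume f: "bilinear f"
  then have "bilinear (\<lambda>a b. f b a)"
    by (simp add: bilinear_def)
  with f assms show "ev2 (flip s (flip s t)) f = ev2 t f"
    by (simp add: ev2_flip flip_closed)
qed

lemma tensor_map_closed: "t \<in> carrier H2 \<Longrightarrow> tensor_map s F G t \<in> carrier H2"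
  unfolding tensor_map_def by (intro lift2_tensor_closed pure2_closed)

lemma ev2_tensor_map:
  "t \<in> carrier H2 \<Longrightarrow> bilinear f \<Longrightarrow> ev2 (tensor_map s F G t) f = ev2 t (\<lambda>a b. f (F a) (G b))"
  unfolding tensor_map_def by (simp add: ev2_lift2_tensor pure2_closed ev2_pure)

lemma tensor_map_tensor_map:
  assumes "t \<in> carrier H2" "linear_op F" "linear_op G"
  shows "tensor_map s F G (tensor_map s F' G' t) = tensor_map s (F \<circ> F') (G \<circ> G') t"
proof (intro tensor2_eqI tensor_map_closed assms)
  fix f assume f: "bilinear f"
  then have "bilinear (\<lambda>a b. f (F a) (G b))"
    using assms by (intro linear_intros linear_form_bilinear[OF f])
  with f assms show "ev2 (tensor_map s F G (tensor_map s F' G' t)) f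
      = ev2 (tensor_map s (F \<circ> F') (G \<circ> G') t) f"
    by (simp add: ev2_tensor_map tensor_map_closed)
qed

lemma inv_leg12:
  assumes "t \<in> Units H2"
  shows "inv\<^bsub>H3\<^esub> (leg12 s t) = leg12 s (inv\<^bsub>H2\<^esub> t)"
proof (rule H3.inv_unique'[symmetric])
  have one: "leg12 s u \<otimes>\<^bsub>H3\<^esub> leg12 s v = \<one>\<^bsub>H3\<^esub>"
    if uv: "u \<in> carrier H2" "v \<in> carrier H2" "u \<otimes>\<^bsub>H2\<^esub> v = \<one>\<^bsub>H2\<^esub>" for u v
  proof (intro tensor3_eqI mult_closed one_closed leg_closed uv)
    fix f assume f: "trilinear f"
    note lin = linear_form_trilinear[OF f] linear_intros
    have "ev3 (leg12 s u \<otimes>\<^bsub>H3\<^esub> leg12 s v) f = ev2 (u \<otimes>\<^bsub>H2\<^esub> v) (\<lambda>a b. f a b 1)"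
      using uv(1,2) f by (simp add: ev3_mult ev3_leg ev2_mult leg_closed lin)
    also have "\<dots> = ev3 \<one>\<^bsub>H3\<^esub> f"
      using f by (simp add: uv(3) ev2_one ev3_one lin)
    finally show "ev3 (leg12 s u \<otimes>\<^bsub>H3\<^esub> leg12 s v) f = ev3 \<one>\<^bsub>H3\<^esub> f" .
  qed
  show "leg12 s t \<otimes>\<^bsub>H3\<^esub> leg12 s (inv\<^bsub>H2\<^esub> t) = \<one>\<^bsub>H3\<^esub>" "leg12 s (inv\<^bsub>H2\<^esub> t) \<otimes>\<^bsub>H3\<^esub> leg12 s t = \<one>\<^bsub>H3\<^esub>"
    using assms by (simp_all add: one H2.Units_closed)
qed (use assms in \<open>simp_all add: leg_closed H2.Units_closed\<close>)

lemma inv_leg23: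
  assumes "t \<in> Units H2"
  shows "inv\<^bsub>H3\<^esub> (leg23 s t) = leg23 s (inv\<^bsub>H2\<^esub> t)"
proof (rule H3.inv_unique'[symmetric])
  have one: "leg23 s u \<otimes>\<^bsub>H3\<^esub> leg23 s v = \<one>\<^bsub>H3\<^esub>"
    if uv: "u \<in> carrier H2" "v \<in> carrier H2" "u \<otimes>\<^bsub>H2\<^esub> v = \<one>\<^bsub>H2\<^esub>" for u v
  proof (intro tensor3_eqI mult_closed one_closed leg_closed uv)
    fix f assume f: "trilinear f"
    note lin = linear_form_trilinear[OF f] linear_intros
    have "ev3 (leg23 s u \<otimes>\<^bsub>H3\<^esub> leg23 s v) f = ev2 (u \<otimes>\<^bsub>H2\<^esub> v) (\<lambda>a b. f 1 a b)"
      using uv(1,2) f by (simp add: ev3_mult ev3_leg ev2_mult leg_closed lin)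
    also have "\<dots> = ev3 \<one>\<^bsub>H3\<^esub> f"
      using f by (simp add: uv(3) ev2_one ev3_one lin)
    finally show "ev3 (leg23 s u \<otimes>\<^bsub>H3\<^esub> leg23 s v) f = ev3 \<one>\<^bsub>H3\<^esub> f" .
  qed
  show "leg23 s t \<otimes>\<^bsub>H3\<^esub> leg23 s (inv\<^bsub>H2\<^esub> t) = \<one>\<^bsub>H3\<^esub>" "leg23 s (inv\<^bsub>H2\<^esub> t) \<otimes>\<^bsub>H3\<^esub> leg23 s t = \<one>\<^bsub>H3\<^esub>"
    using assms by (simp_all add: one H2.Units_closed)
qed (use assms in \<open>simp_all add: leg_closed H2.Units_closed\<close>)

end

section \<open>Coproduct and counit in terms of evaluations\<close>

context bialgebra
begin

lemma linear_form_counit: "linear_op L \<Longrightarrow> linear_form (\<lambda>x. \<epsilon> (L x))"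
  using linear_form_compose[OF counit_linear] .

lemma linear_form_comult:
  assumes "bilinear g" "linear_op L"
  shows "linear_form (\<lambda>x. ev2 (\<Delta> (L x)) g)"
  using assms
  by (intro linear_formI)
    (simp_all add: linear_opD comult_add comult_scale ev2_add ev2_smult comult_closed)

lemmas bialgebra_linear_intros =
  linear_intros linear_form_counit linear_form_comult linear_form_mult_const[OF linear_form_counit]

lemma ev3_comult_left:
  assumes "t \<in> carrier H2" "trilinear f"
  shows "ev3 (comult_left s \<Delta> t) f = ev2 t (\<lambda>a b. ev2 (\<Delta> a) (\<lambda>x y. f x y b))"
  unfolding comult_left_def using assms
  by (simp add: ev3_lift2_tensor lift2_tensor_closed pure3_closed comult_closed ev3_pure)

lemma ev3_comult_right:
  assumes "t \<in> carrier H2" "trilinear f"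
  shows "ev3 (comult_right s \<Delta> t) f = ev2 t (\<lambda>a b. ev2 (\<Delta> b) (\<lambda>x y. f a x y))"
  unfolding comult_right_def using assms
  by (simp add: ev3_lift2_tensor lift2_tensor_closed pure3_closed comult_closed ev3_pure)

lemma ev2_coassoc:
  assumes "trilinear f"
  shows "ev2 (\<Delta> h) (\<lambda>a b. ev2 (\<Delta> a) (\<lambda>x y. f x y b)) = ev2 (\<Delta> h) (\<lambda>a b. ev2 (\<Delta> b) (\<lambda>x y. f a x y))"
  using arg_cong[OF coassoc[of h], of "\<lambda>t. ev3 t f"]
  by (simp add: ev3_comult_left ev3_comult_right comult_closed assms)

lemma ev2_counit:
  assumes "linear_form \<phi>"
  shows "ev2 (\<Delta> h) (\<lambda>a b. \<epsilon> a * \<phi> b) = \<phi> h" "ev2 (\<Delta> h) (\<lambda>a b. \<epsilon> b * \<phi> a) = \<phi> h"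
  using arg_cong[OF counit_left[of h], of \<phi>] arg_cong[OF counit_right[of h], of \<phi>]
  by (simp_all add: linear_form_lift2[OF assms] linear_formD[OF assms])

end

section \<open>The antipode reverses products\<close>

context hopf_algebra
begin

lemma linear_op_antipode: "linear_op L \<Longrightarrow> linear_op (\<lambda>x. S (L x))"
  using linear_op_compose[OF antipode_linear] .

lemmas hopf_linear_intros = bialgebra_linear_intros linear_op_antipode

lemma ev2_antipode:
  assumes "linear_form \<phi>"
  shows "ev2 (\<Delta> h) (\<lambda>a b. \<phi> (S a * b)) = \<epsilon> h * \<phi> 1" "ev2 (\<Delta> h) (\<lambda>a b. \<phi> (a * S b)) = \<epsilon> h * \<phi> 1"
  using arg_cong[OF antipode_left[of h], of \<phi>] arg_cong[OF antipode_right[of h], of \<phi>]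
  by (simp_all add: linear_form_lift2[OF assms] linear_formD[OF assms])

text \<open>Since \<open>\<Delta> 1\<close> is 1 \<otimes> 1, the left antipode axiom at 1 reads
  \<open>S 1 * 1 = 1\<close>.\<close>

lemma antipode_one: "S 1 = 1"
proof (rule eqI_linear_form)
  fix \<phi> assume \<phi>: "linear_form \<phi>"
  have "bilinear (\<lambda>a b. \<phi> (S a * b))"
    by (intro hopf_linear_intros linear_form_compose[OF \<phi>])
  then show "\<phi> (S 1) = \<phi> 1"
    using ev2_antipode(1)[OF \<phi>, of 1] by (simp add: comult_one ev2_one counit_one)
qed

text \<open>With \<open>x1\<close>, \<open>x2\<close>, \<open>x3\<close> and \<open>y1\<close>,
  \<open>y2\<close>, \<open>y3\<close> the legs of the twofold coproducts, the sum of
  \<open>S y1 * S x1 * x2 * y2 * S (x3 * y3)\<close> is computed in two ways. Contracting on the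
  right gives \<open>S y * S x\<close>, contracting on the left gives
  \<open>S (x * y)\<close>.\<close>

lemma antipode_mult: "S (x * y) = S y * S x"
proof (rule eqI_linear_form)
  fix \<phi> assume \<phi>: "linear_form \<phi>"
  note lin = hopf_linear_intros linear_form_compose[OF \<phi>]
  \<comment> \<open>The sum over the legs of \<open>y\<close>, with the three legs of
    \<open>x\<close> left as the variables \<open>a\<close>, \<open>b\<close>,
    \<open>c\<close>.\<close>
  let ?G = "\<lambda>a b c. ev2 (\<Delta> y) (\<lambda>p q. ev2 (\<Delta> q) (\<lambda>u v. \<phi> (S p * S a * b * u * S (c * v))))"
  have "\<phi> (S y * S x) = ev2 (\<Delta> x) (\<lambda>a b. \<epsilon> b * \<phi> (S y * S a))"
    by (rule ev2_counit(2)[symmetric]) (intro lin)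
  also have "\<dots> = ev2 (\<Delta> x) (\<lambda>a b. \<epsilon> b * ev2 (\<Delta> y) (\<lambda>p q. \<epsilon> q * \<phi> (S p * S a)))"
    by (intro ev2_cong arg_cong[of _ _ "(*) _"] ev2_counit(2)[symmetric]) (intro lin)
  \<comment> \<open>The trailing \<open>1\<close> marks the place where the right antipode axiom for
    \<open>b * q\<close> is inserted next, which creates the antipode of a product.\<close>
  also have "\<dots> = ev2 (\<Delta> x) (\<lambda>a b. ev2 (\<Delta> y) (\<lambda>p q. \<epsilon> (b * q) * \<phi> (S p * S a * 1)))"
    by (simp add: ev2_const_mult[symmetric] counit_mult mult.assoc)
  also have "\<dots> = ev2 (\<Delta> x) (\<lambda>a b. ev2 (\<Delta> y) (\<lambda>p q. ev2 (\<Delta> (b * q)) (\<lambda>u v.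
      \<phi> (S p * S a * (u * S v)))))"
    by (intro ev2_cong ev2_antipode(2)[symmetric]) (intro lin)
  also have "\<dots> = ev2 (\<Delta> x) (\<lambda>a b. ev2 (\<Delta> y) (\<lambda>p q. ev2 (\<Delta> b) (\<lambda>c d. ev2 (\<Delta> q) (\<lambda>u v.
      \<phi> (S p * S a * ((c * u) * S (d * v)))))))"
    by (simp add: comult_mult ev2_mult comult_closed lin)
  also have "\<dots> = ev2 (\<Delta> x) (\<lambda>a b. ev2 (\<Delta> b) (\<lambda>c d. ?G a c d))"
    by (simp add: ev2_commute[of "\<Delta> y"] mult.assoc)
  \<comment> \<open>Coassociativity makes \<open>S c\<close> and \<open>d\<close> legs of one
    coproduct, so that they contract.\<close>
  also have "\<dots> = ev2 (\<Delta> x) (\<lambda>a b. ev2 (\<Delta> a) (\<lambda>c d. ?G c d b))"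
    by (rule ev2_coassoc[symmetric]) (intro lin)
  also have "\<dots> = ev2 (\<Delta> x) (\<lambda>a b. \<epsilon> a * ?G 1 1 b)"
  proof (rule ev2_cong)
    fix a b
    have "ev2 (\<Delta> a) (\<lambda>c d. ?G c d b)
        = ev2 (\<Delta> a) (\<lambda>c d. ev2 (\<Delta> y) (\<lambda>p q. ev2 (\<Delta> q) (\<lambda>u v. \<phi> (S p * (S c * d) * u * S (b * v)))))"
      by (simp add: mult.assoc)
    also have "\<dots> = \<epsilon> a * ev2 (\<Delta> y) (\<lambda>p q. ev2 (\<Delta> q) (\<lambda>u v. \<phi> (S p * 1 * u * S (b * v))))"
      by (rule ev2_antipode(1)) (intro lin)
    finally show "ev2 (\<Delta> a) (\<lambda>c d. ?G c d b) = \<epsilon> a * ?G 1 1 b"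
      by (simp add: antipode_one)
  qed
  also have "\<dots> = ?G 1 1 x"
    by (rule ev2_counit) (intro lin)
  \<comment> \<open>The same regrouping for the legs of \<open>y\<close>.\<close>
  also have "\<dots> = ev2 (\<Delta> y) (\<lambda>p q. ev2 (\<Delta> p) (\<lambda>u v. \<phi> (S u * v * S (x * q))))"
    unfolding antipode_one mult_1_right
    by (rule ev2_coassoc[symmetric]) (intro lin)
  also have "\<dots> = ev2 (\<Delta> y) (\<lambda>p q. \<epsilon> p * \<phi> (1 * S (x * q)))"
    by (intro ev2_cong ev2_antipode(1)) (intro lin)
  also have "\<dots> = \<phi> (1 * S (x * y))"
    by (rule ev2_counit) (intro lin)
  finally show "\<phi> (S (x * y)) = \<phi> (S y * S x)"
    by simp
qed

lemma antipode_tensor_mult: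
  assumes "t \<in> carrier H2" "u \<in> carrier H2"
  shows "tensor_map s S S (t \<otimes>\<^bsub>H2\<^esub> u) = tensor_map s S S u \<otimes>\<^bsub>H2\<^esub> tensor_map s S S t"
proof (intro tensor2_eqI mult_closed tensor_map_closed assms)
  fix f assume f: "bilinear f"
  note lin = hopf_linear_intros linear_form_bilinear[OF f]
  have "ev2 (tensor_map s S S (t \<otimes>\<^bsub>H2\<^esub> u)) f
      = ev2 t (\<lambda>a b. ev2 u (\<lambda>c d. f (S c * S a) (S d * S b)))"
    using f assms by (simp add: ev2_tensor_map ev2_mult mult_closed antipode_mult lin)
  also have "\<dots> = ev2 u (\<lambda>c d. ev2 t (\<lambda>a b. f (S c * S a) (S d * S b)))"
    by (rule ev2_commute)
  also have "\<dots> = ev2 (tensor_map s S S u \<otimes>\<^bsub>H2\<^esub> tensor_map s S S t) f"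
    using f assms by (simp add: ev2_tensor_map ev2_mult tensor_map_closed lin)
  finally show "ev2 (tensor_map s S S (t \<otimes>\<^bsub>H2\<^esub> u)) f
      = ev2 (tensor_map s S S u \<otimes>\<^bsub>H2\<^esub> tensor_map s S S t) f" .
qed

end

section \<open>The universal R-matrix\<close>

context quasitriangular_hopf_algebra
begin

abbreviation R_inv :: "('k, 'h) tensor"
  where "R_inv \<equiv> inv\<^bsub>H2\<^esub> R"

lemmas R_closed = H2.Units_closed[OF R_invertible]
lemmas R_inv_closed = H2.Units_inv_closed[OF R_invertible]

lemma ev2_R_cancel:
  assumes "bilinear f"
  shows "ev2 R (\<lambda>a b. ev2 R_inv (\<lambda>c d. f (a * c) (b * d))) = f 1 1"
    and "ev2 R_inv (\<lambda>a b. ev2 R (\<lambda>c d. f (a * c) (b * d))) = f 1 1"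
  using assms H2.Units_r_inv[OF R_invertible] H2.Units_l_inv[OF R_invertible]
  by (simp_all add: ev2_mult[symmetric] ev2_one R_closed R_inv_closed)

text \<open>
  A factor \<open>R\<close> or \<open>R\<inverse>\<close> is moved to the other side of an identity by evaluating the identity at
  a translate of \<open>f\<close> by the inverse factor.
\<close>

lemma ev2_R_left:
  assumes "trilinear f"
  shows "ev2 R (\<lambda>a b. ev2 (\<Delta> a) (\<lambda>x y. f x y b)) = ev2 R (\<lambda>a b. ev2 R (\<lambda>c d. f a c (b * d)))"
proof -
  note lin = hopf_linear_intros linear_form_trilinear[OF assms]
  show ?thesis
    using arg_cong[OF R_comult_left, of "\<lambda>t. ev3 t f"] assms
    by (simp add: ev3_comult_left ev3_mult ev3_leg leg_closed R_closed lin)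
qed

lemma ev2_R_right:
  assumes "trilinear f"
  shows "ev2 R (\<lambda>a b. ev2 (\<Delta> b) (\<lambda>x y. f a x y)) = ev2 R (\<lambda>a b. ev2 R (\<lambda>c d. f (a * c) d b))"
proof -
  note lin = hopf_linear_intros linear_form_trilinear[OF assms]
  show ?thesis
    using arg_cong[OF R_comult_right, of "\<lambda>t. ev3 t f"] assms
    by (simp add: ev3_comult_right ev3_mult ev3_leg leg_closed R_closed lin)
qed

text \<open>Applying \<epsilon> to the first leg of the axiom for (\<Delta> \<otimes> Id)(R) shows
  that \<open>R\<close> equals 1 \<otimes> (\<epsilon> \<otimes> Id)(R) times \<open>R\<close>, and
  \<open>R\<close> cancels.\<close>

lemma ev2_R_counit:
  assumes \<phi>: "linear_form \<phi>"
  shows "ev2 R (\<lambda>a b. \<epsilon> a * \<phi> b) = \<phi> 1" "ev2 R (\<lambda>a b. \<epsilon> b * \<phi> a) = \<phi> 1"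
proof -
  note lin = hopf_linear_intros linear_form_compose[OF \<phi>] linear_form_mult_const
  \<comment> \<open>The form \<epsilon> \<otimes> \<phi> translated by \<open>R_inv\<close> on the
    right, which performs this cancellation.\<close>
  let ?f = "\<lambda>c d. ev2 R_inv (\<lambda>p q. \<epsilon> (c * p) * \<phi> (d * q))"
  have "\<phi> 1 = ev2 R ?f"
    by (subst ev2_R_cancel(1)) (auto intro!: lin simp: counit_one)
  also have "\<dots> = ev2 R (\<lambda>a b. ev2 (\<Delta> a) (\<lambda>x y. \<epsilon> x * ?f y b))"
    by (intro ev2_cong ev2_counit[symmetric] lin)
  also have "\<dots> = ev2 R (\<lambda>a b. ev2 R (\<lambda>c d. \<epsilon> a * ?f c (b * d)))"
    by (intro ev2_R_left lin)
  also have "\<dots> = ev2 R (\<lambda>a b. \<epsilon> a * ev2 R (\<lambda>c d. ev2 R_inv (\<lambda>p q. \<epsilon> (c * p) * \<phi> (b * (d * q)))))"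
    by (simp add: ev2_const_mult mult.assoc)
  also have "\<dots> = ev2 R (\<lambda>a b. \<epsilon> a * (\<epsilon> 1 * \<phi> (b * 1)))"
    by (intro ev2_cong arg_cong[of _ _ "(*) _"] ev2_R_cancel(1)) (intro lin)
  finally show "ev2 R (\<lambda>a b. \<epsilon> a * \<phi> b) = \<phi> 1"
    by (simp add: counit_one)
  \<comment> \<open>The mirror image, with \<epsilon> on the last leg of the axiom for (Id \<otimes>
    \<Delta>)(R).\<close>
  let ?g = "\<lambda>c d. ev2 R_inv (\<lambda>p q. \<phi> (c * p) * \<epsilon> (d * q))"
  have "\<phi> 1 = ev2 R ?g"
    by (subst ev2_R_cancel(1)) (auto intro!: lin simp: counit_one)
  also have "\<dots> = ev2 R (\<lambda>a b. ev2 (\<Delta> b) (\<lambda>x y. \<epsilon> y * ?g a x))"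
    by (intro ev2_cong ev2_counit[symmetric] lin)
  also have "\<dots> = ev2 R (\<lambda>a b. ev2 R (\<lambda>c d. \<epsilon> b * ?g (a * c) d))"
    by (intro ev2_R_right lin)
  also have "\<dots> = ev2 R (\<lambda>a b. \<epsilon> b * ev2 R (\<lambda>c d. ev2 R_inv (\<lambda>p q. \<phi> (a * (c * p)) * \<epsilon> (d * q))))"
    by (simp add: ev2_const_mult mult.assoc)
  also have "\<dots> = ev2 R (\<lambda>a b. \<epsilon> b * (\<phi> (a * 1) * \<epsilon> 1))"
    by (intro ev2_cong arg_cong[of _ _ "(*) _"] ev2_R_cancel(1)) (intro lin)
  finally show "ev2 R (\<lambda>a b. \<epsilon> b * \<phi> a) = \<phi> 1"
    by (simp add: counit_one)
qed

text \<open>Contracting the first two legs of (\<Delta> \<otimes> Id)(R) with \<open>S x * y\<close>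
  gives 1 \<otimes> 1 by the counit property, and (S \<otimes> Id)(R) times \<open>R\<close> by the
  hexagon axiom.\<close>

lemma ev2_R_antipode:
  assumes f: "bilinear f"
  shows "ev2 R (\<lambda>a b. f (S a) b) = ev2 R_inv f"
proof -
  note lin = hopf_linear_intros linear_form_bilinear[OF f] linear_form_mult_const
  let ?f = "\<lambda>u v. ev2 R_inv (\<lambda>p q. f (u * p) (v * q))"
  have "ev2 R_inv f = ?f 1 1"
    by simp
  also have "\<dots> = ev2 R (\<lambda>a b. \<epsilon> a * ?f 1 b)"
    by (intro ev2_R_counit[symmetric] lin)
  also have "\<dots> = ev2 R (\<lambda>a b. ev2 (\<Delta> a) (\<lambda>x y. ?f (S x * y) b))"
    by (intro ev2_cong ev2_antipode(1)[symmetric] lin)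
  also have "\<dots> = ev2 R (\<lambda>a b. ev2 R (\<lambda>c d. ?f (S a * c) (b * d)))"
    by (intro ev2_R_left lin)
  also have "\<dots> = ev2 R (\<lambda>a b. ev2 R (\<lambda>c d. ev2 R_inv (\<lambda>p q. f (S a * (c * p)) (b * (d * q)))))"
    by (simp only: mult.assoc)
  also have "\<dots> = ev2 R (\<lambda>a b. f (S a * 1) (b * 1))"
    by (intro ev2_cong ev2_R_cancel lin)
  finally show ?thesis
    by simp
qed

text \<open>Applying \<open>S\<close> to the first leg of (Id \<otimes> \<Delta>)(R) and contracting
  the others with \<open>x * S y\<close> gives 1 \<otimes> 1. As \<open>S\<close> reverses the
  product in the first leg, the hexagon axiom turns this into \<open>R_inv\<close> times (S
  \<otimes> S)(R). The translate \<open>?f\<close> supplies the factor \<open>R\<close> that cancels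
  \<open>R_inv\<close>.\<close>

lemma ev2_R_antipode_antipode:
  assumes f: "bilinear f"
  shows "ev2 R (\<lambda>a b. f (S a) (S b)) = ev2 R f"
proof -
  note lin = hopf_linear_intros linear_form_bilinear[OF f] linear_form_mult_const
  let ?f = "\<lambda>u v. ev2 R (\<lambda>p q. f (p * u) (q * v))"
  have "ev2 R f = ?f 1 1"
    by simp
  also have "\<dots> = ev2 R (\<lambda>a b. \<epsilon> b * ?f (S a) 1)"
    by (subst ev2_R_counit(2)) (auto intro!: lin simp: antipode_one)
  also have "\<dots> = ev2 R (\<lambda>a b. ev2 (\<Delta> b) (\<lambda>x y. ?f (S a) (x * S y)))"
    by (intro ev2_cong ev2_antipode(2)[symmetric] lin)
  also have "\<dots> = ev2 R (\<lambda>a b. ev2 R (\<lambda>c d. ?f (S (a * c)) (d * S b)))"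
    by (intro ev2_R_right lin)
  also have "\<dots> = ev2 R (\<lambda>a b. ev2 R (\<lambda>c d. ?f (S c * S a) (d * S b)))"
    by (simp only: antipode_mult)
  also have "\<dots> = ev2 R (\<lambda>a b. ev2 R_inv (\<lambda>c d. ?f (c * S a) (d * S b)))"
    by (intro ev2_cong ev2_R_antipode lin)
  also have "\<dots> = ev2 R (\<lambda>a b. ev2 R (\<lambda>p q. ev2 R_inv (\<lambda>c d. f (p * c * S a) (q * d * S b))))"
    by (simp only: ev2_commute[of R_inv] mult.assoc)
  also have "\<dots> = ev2 R (\<lambda>a b. f (1 * S a) (1 * S b))"
    by (intro ev2_cong ev2_R_cancel lin)
  finally show ?thesis
    by simp
qed

text \<open>\<open>R_inv\<close> is (S \<otimes> Id)(R), and S \<otimes> S commutes with S \<otimes>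
  Id and fixes \<open>R\<close>.\<close>

lemma antipode_R_inv: "tensor_map s S S R_inv = R_inv"
proof (intro tensor2_eqI tensor_map_closed R_inv_closed)
  fix f assume f: "bilinear f"
  note lin = hopf_linear_intros linear_form_bilinear[OF f]
  have "ev2 (tensor_map s S S R_inv) f = ev2 R_inv (\<lambda>a b. f (S a) (S b))"
    using f by (simp add: ev2_tensor_map R_inv_closed)
  also have "\<dots> = ev2 R (\<lambda>a b. f (S (S a)) (S b))"
    by (intro ev2_R_antipode[symmetric] lin)
  also have "\<dots> = ev2 R (\<lambda>a b. f (S a) b)"
    by (intro ev2_R_antipode_antipode lin)
  also have "\<dots> = ev2 R_inv f"
    by (rule ev2_R_antipode[OF f])
  finally show "ev2 (tensor_map s S S R_inv) f = ev2 R_inv f" .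
qed

end

section \<open>The infinitesimal R-matrix\<close>

context pre_cartier
begin

lemma ev2_chi_left:
  assumes "trilinear f"
  shows "ev2 \<chi> (\<lambda>a b. ev2 (\<Delta> a) (\<lambda>x y. f x y b)) = ev2 \<chi> (\<lambda>a b. f 1 a b)
    + ev2 R_inv (\<lambda>p q. ev2 \<chi> (\<lambda>a b. ev2 R (\<lambda>c d. f a (p * c) (q * b * d))))"
proof -
  note lin = hopf_linear_intros linear_form_trilinear[OF assms]
  show ?thesis
    using arg_cong[OF chi_comult_left, of "\<lambda>t. ev3 t f"] assms
    by (simp add: inv_leg23 R_invertible ev3_comult_left ev3_mult ev3_add ev3_leg leg_closed
        mult_closed chi_closed R_closed R_inv_closed lin)
qed

lemma ev2_chi_right:
  assumes "trilinear f"
  shows "ev2 \<chi> (\<lambda>a b. ev2 (\<Delta> b) (\<lambda>x y. f a x y)) = ev2 \<chi> (\<lambda>a b. f a b 1)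
    + ev2 R_inv (\<lambda>p q. ev2 \<chi> (\<lambda>a b. ev2 R (\<lambda>c d. f (p * a * c) (q * d) b)))"
proof -
  note lin = hopf_linear_intros linear_form_trilinear[OF assms]
  show ?thesis
    using arg_cong[OF chi_comult_right, of "\<lambda>t. ev3 t f"] assms
    by (simp add: inv_leg12 R_invertible ev3_comult_right ev3_mult ev3_add ev3_leg leg_closed
        mult_closed chi_closed R_closed R_inv_closed lin)
qed

text \<open>Conjugating x \<otimes> y by \<open>R_inv\<close> and then by \<open>R\<close> changes
  nothing. It serves to undo the conjugation in the axioms for \<chi>.\<close>

lemma ev2_R_conj_cancel:
  assumes "bilinear f"
  shows "ev2 R_inv (\<lambda>p q. ev2 R (\<lambda>c d. ev2 R (\<lambda>m n. ev2 R_inv (\<lambda>i j.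
    f (m * (p * x * c) * i) (n * (q * y * d) * j))))) = f x y"
proof -
  note lin = hopf_linear_intros linear_form_bilinear[OF assms]
  have "ev2 R_inv (\<lambda>p q. ev2 R (\<lambda>c d. ev2 R (\<lambda>m n. ev2 R_inv (\<lambda>i j.
      f (m * (p * x * c) * i) (n * (q * y * d) * j)))))
    = ev2 R_inv (\<lambda>p q. ev2 R (\<lambda>m n. ev2 R (\<lambda>c d. ev2 R_inv (\<lambda>i j.
      f (m * p * x * (c * i)) (n * q * y * (d * j))))))"
    \<comment> \<open>Swapping the two evaluations at \<open>R\<close> puts \<open>c\<close>,
      \<open>d\<close> directly before the inverse factors \<open>i\<close>,
      \<open>j\<close>.\<close>
    by (subst ev2_commute[of R R]) (simp only: mult.assoc)
  also have "\<dots> = ev2 R_inv (\<lambda>p q. ev2 R (\<lambda>m n. f (m * p * x * 1) (n * q * y * 1)))"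
    by (intro ev2_cong ev2_R_cancel lin)
  also have "\<dots> = ev2 R (\<lambda>m n. ev2 R_inv (\<lambda>p q. f (m * p * x) (n * q * y)))"
    by (subst ev2_commute) simp
  also have "\<dots> = f (1 * x) (1 * y)"
    by (intro ev2_R_cancel lin)
  finally show ?thesis
    by simp
qed

text \<open>After \<epsilon> is applied to an outer leg, the left side of the axiom and its
  unconjugated summand are both \<chi>. Hence the conjugated summand vanishes.\<close>

lemma ev2_chi_counit:
  assumes \<phi>: "linear_form \<phi>"
  shows "ev2 \<chi> (\<lambda>a b. \<epsilon> a * \<phi> b) = 0" "ev2 \<chi> (\<lambda>a b. \<epsilon> b * \<phi> a) = 0"
proof -
  note lin = hopf_linear_intros linear_form_compose[OF \<phi>] linear_form_mult_const
  \<comment> \<open>The form is precomposed with conjugation by \<open>R\<close>, which is inverse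
    to the conjugation in the axioms.\<close>
  let ?conj = "\<lambda>f u v. ev2 R (\<lambda>m n. ev2 R_inv (\<lambda>i j. f (m * u * i) (n * v * j)))"
  let ?f = "?conj (\<lambda>a b. \<epsilon> a * \<phi> b)"
  have "ev2 \<chi> ?f = ev2 \<chi> (\<lambda>a b. ev2 (\<Delta> a) (\<lambda>x y. \<epsilon> x * ?f y b))"
    by (intro ev2_cong ev2_counit[symmetric] lin)
  also have "\<dots> = ev2 \<chi> (\<lambda>a b. \<epsilon> 1 * ?f a b)
      + ev2 R_inv (\<lambda>p q. ev2 \<chi> (\<lambda>a b. ev2 R (\<lambda>c d. \<epsilon> a * ?f (p * c) (q * b * d))))"
    by (intro ev2_chi_left lin)
  \<comment> \<open>The inserted \<open>1\<close> exhibits the arguments of \<open>?f\<close> as the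
    conjugate of 1 \<otimes> b, the shape that \<open>ev2_R_conj_cancel\<close> expects.\<close>
  also have "ev2 R_inv (\<lambda>p q. ev2 \<chi> (\<lambda>a b. ev2 R (\<lambda>c d. \<epsilon> a * ?f (p * c) (q * b * d))))
      = ev2 \<chi> (\<lambda>a b. \<epsilon> a * ev2 R_inv (\<lambda>p q. ev2 R (\<lambda>c d. ?f (p * 1 * c) (q * b * d))))"
    by (subst ev2_commute) (simp add: ev2_const_mult)
  also have "\<dots> = ev2 \<chi> (\<lambda>a b. \<epsilon> a * (\<epsilon> 1 * \<phi> b))"
    by (intro ev2_cong arg_cong[of _ _ "(*) _"] ev2_R_conj_cancel lin)
  finally show "ev2 \<chi> (\<lambda>a b. \<epsilon> a * \<phi> b) = 0"
    by (simp add: counit_one)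
  \<comment> \<open>The mirror image, with \<epsilon> on the last leg of (Id \<otimes>
    \<Delta>)(\<chi>).\<close>
  let ?g = "?conj (\<lambda>a b. \<phi> a * \<epsilon> b)"
  have "ev2 \<chi> ?g = ev2 \<chi> (\<lambda>a b. ev2 (\<Delta> b) (\<lambda>x y. \<epsilon> y * ?g a x))"
    by (intro ev2_cong ev2_counit[symmetric] lin)
  also have "\<dots> = ev2 \<chi> (\<lambda>a b. \<epsilon> 1 * ?g a b)
      + ev2 R_inv (\<lambda>p q. ev2 \<chi> (\<lambda>a b. ev2 R (\<lambda>c d. \<epsilon> b * ?g (p * a * c) (q * d))))"
    by (intro ev2_chi_right lin)
  also have "ev2 R_inv (\<lambda>p q. ev2 \<chi> (\<lambda>a b. ev2 R (\<lambda>c d. \<epsilon> b * ?g (p * a * c) (q * d))))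
      = ev2 \<chi> (\<lambda>a b. \<epsilon> b * ev2 R_inv (\<lambda>p q. ev2 R (\<lambda>c d. ?g (p * a * c) (q * 1 * d))))"
    by (subst ev2_commute) (simp add: ev2_const_mult)
  also have "\<dots> = ev2 \<chi> (\<lambda>a b. \<epsilon> b * (\<phi> a * \<epsilon> 1))"
    by (intro ev2_cong arg_cong[of _ _ "(*) _"] ev2_R_conj_cancel lin)
  finally show "ev2 \<chi> (\<lambda>a b. \<epsilon> b * \<phi> a) = 0"
    by (simp add: counit_one)
qed

text \<open>Contracting (\<Delta> \<otimes> Id)(\<chi>) with \<open>S x * y\<close> gives 0, because
  \<epsilon> kills the first leg of \<chi>. The two summands on the other side of the axiom are
  therefore opposite.\<close>

lemma ev2_chi_antipode_left:
  assumes f: "bilinear f"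
  shows "ev2 \<chi> (\<lambda>a b. ev2 R_inv (\<lambda>c d. f (S a * c) (d * b)))
    = - ev2 \<chi> (\<lambda>a b. ev2 R_inv (\<lambda>c d. f (a * c) (b * d)))"
proof -
  note lin = hopf_linear_intros linear_form_bilinear[OF f] linear_form_mult_const
  \<comment> \<open>Translation by \<open>R_inv\<close> on the right removes the rightmost
    \<open>R\<close> of the conjugated summand.\<close>
  let ?f = "\<lambda>u v. ev2 R_inv (\<lambda>m n. f (u * m) (v * n))"
  have "0 = ev2 \<chi> (\<lambda>a b. \<epsilon> a * ?f 1 b)"
    by (intro ev2_chi_counit[symmetric] lin)
  also have "\<dots> = ev2 \<chi> (\<lambda>a b. ev2 (\<Delta> a) (\<lambda>x y. ?f (S x * y) b))"
    by (intro ev2_cong ev2_antipode(1)[symmetric] lin)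
  also have "\<dots> = ev2 \<chi> (\<lambda>a b. ?f (S 1 * a) b)
      + ev2 R_inv (\<lambda>p q. ev2 \<chi> (\<lambda>a b. ev2 R (\<lambda>c d. ?f (S a * (p * c)) (q * b * d))))"
    by (intro ev2_chi_left lin)
  also have "ev2 R_inv (\<lambda>p q. ev2 \<chi> (\<lambda>a b. ev2 R (\<lambda>c d. ?f (S a * (p * c)) (q * b * d))))
      = ev2 R_inv (\<lambda>p q. ev2 \<chi> (\<lambda>a b. ev2 R (\<lambda>c d. ev2 R_inv (\<lambda>m n.
          f (S a * p * (c * m)) (q * b * (d * n))))))"
    by (simp only: mult.assoc)
  also have "\<dots> = ev2 R_inv (\<lambda>p q. ev2 \<chi> (\<lambda>a b. f (S a * p * 1) (q * b * 1)))"
    by (intro ev2_cong ev2_R_cancel lin)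
  also have "\<dots> = ev2 \<chi> (\<lambda>a b. ev2 R_inv (\<lambda>p q. f (S a * p) (q * b)))"
    by (subst ev2_commute) simp
  finally show ?thesis
    by (simp add: antipode_one add_eq_0_iff)
qed

text \<open>The mirror argument: (Id \<otimes> \<Delta>)(\<chi>) is contracted with
  \<open>x * S y\<close>, and \<epsilon> kills the second leg of \<chi>.\<close>

lemma ev2_chi_antipode_right:
  assumes f: "bilinear f"
  shows "ev2 \<chi> (\<lambda>a b. ev2 R (\<lambda>c d. f (a * c) (d * S b)))
    = - ev2 \<chi> (\<lambda>a b. ev2 R (\<lambda>c d. f (c * a) (d * b)))"
proof -
  note lin = hopf_linear_intros linear_form_bilinear[OF f] linear_form_mult_const
  \<comment> \<open>Here the translation is by \<open>R\<close> on the left, to remove the leftmost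
    \<open>R_inv\<close> of the conjugated summand.\<close>
  let ?f = "\<lambda>u v. ev2 R (\<lambda>m n. f (m * u) (n * v))"
  have "0 = ev2 \<chi> (\<lambda>a b. \<epsilon> b * ?f a 1)"
    by (intro ev2_chi_counit[symmetric] lin)
  also have "\<dots> = ev2 \<chi> (\<lambda>a b. ev2 (\<Delta> b) (\<lambda>x y. ?f a (x * S y)))"
    by (intro ev2_cong ev2_antipode(2)[symmetric] lin)
  also have "\<dots> = ev2 \<chi> (\<lambda>a b. ?f a (b * S 1))
      + ev2 R_inv (\<lambda>p q. ev2 \<chi> (\<lambda>a b. ev2 R (\<lambda>c d. ?f (p * a * c) (q * d * S b))))"
    by (intro ev2_chi_right lin)
  also have "ev2 R_inv (\<lambda>p q. ev2 \<chi> (\<lambda>a b. ev2 R (\<lambda>c d. ?f (p * a * c) (q * d * S b))))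
      = ev2 \<chi> (\<lambda>a b. ev2 R (\<lambda>c d. ev2 R (\<lambda>m n. ev2 R_inv (\<lambda>p q.
          f (m * p * (a * c)) (n * q * (d * S b))))))"
    by (simp only: ev2_commute[of R_inv] mult.assoc)
  also have "\<dots> = ev2 \<chi> (\<lambda>a b. ev2 R (\<lambda>c d. f (1 * (a * c)) (1 * (d * S b))))"
    by (intro ev2_cong ev2_R_cancel lin)
  finally show ?thesis
    by (simp add: antipode_one add_eq_0_iff)
qed

section \<open>The antipode on \<chi> and the Cartier condition\<close>

lemma R_inv_mult_antipode_chi:
  "R_inv \<otimes>\<^bsub>H2\<^esub> tensor_map s S S \<chi> = \<chi> \<otimes>\<^bsub>H2\<^esub> R_inv"
proof (intro tensor2_eqI mult_closed tensor_map_closed chi_closed R_inv_closed)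
  fix f assume f: "bilinear f"
  note lin = hopf_linear_intros linear_form_bilinear[OF f]
  have "ev2 (R_inv \<otimes>\<^bsub>H2\<^esub> tensor_map s S S \<chi>) f
      = ev2 R_inv (\<lambda>c d. ev2 \<chi> (\<lambda>a b. f (c * S a) (d * S b)))"
    using f by (simp add: ev2_mult ev2_tensor_map tensor_map_closed chi_closed R_inv_closed lin)
  also have "\<dots> = ev2 R (\<lambda>c d. ev2 \<chi> (\<lambda>a b. f (S c * S a) (d * S b)))"
    by (intro ev2_R_antipode[symmetric] lin)
  \<comment> \<open>Joining the two antipodes in the first leg produces the left side of
    \<open>ev2_chi_antipode_right\<close> for the form \<open>f (S u) v\<close>.\<close>
  also have "\<dots> = ev2 \<chi> (\<lambda>a b. ev2 R (\<lambda>c d. f (S (a * c)) (d * S b)))"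
    by (subst ev2_commute) (simp only: antipode_mult)
  also have "\<dots> = - ev2 \<chi> (\<lambda>a b. ev2 R (\<lambda>c d. f (S (c * a)) (d * b)))"
    by (intro ev2_chi_antipode_right lin)
  also have "\<dots> = - ev2 \<chi> (\<lambda>a b. ev2 R (\<lambda>c d. f (S a * S c) (d * b)))"
    by (simp only: antipode_mult)
  \<comment> \<open>Returning from (S \<otimes> Id)(R) to \<open>R_inv\<close> gives the left side
    of \<open>ev2_chi_antipode_left\<close>, whose sign cancels the present one.\<close>
  also have "\<dots> = - ev2 \<chi> (\<lambda>a b. ev2 R_inv (\<lambda>c d. f (S a * c) (d * b)))"
    by (intro arg_cong[of _ _ uminus] ev2_cong ev2_R_antipode lin)
  also have "\<dots> = ev2 \<chi> (\<lambda>a b. ev2 R_inv (\<lambda>c d. f (a * c) (b * d)))"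
    by (simp add: ev2_chi_antipode_left f)
  also have "\<dots> = ev2 (\<chi> \<otimes>\<^bsub>H2\<^esub> R_inv) f"
    using f by (simp add: ev2_mult chi_closed R_inv_closed)
  finally show "ev2 (R_inv \<otimes>\<^bsub>H2\<^esub> tensor_map s S S \<chi>) f = ev2 (\<chi> \<otimes>\<^bsub>H2\<^esub> R_inv) f" .
qed

lemma antipode_chi: "tensor_map s S S \<chi> = R \<otimes>\<^bsub>H2\<^esub> \<chi> \<otimes>\<^bsub>H2\<^esub> R_inv"
proof -
  have "tensor_map s S S \<chi> = R \<otimes>\<^bsub>H2\<^esub> R_inv \<otimes>\<^bsub>H2\<^esub> tensor_map s S S \<chi>"
    by (simp add: R_invertible tensor_map_closed chi_closed)
  also have "\<dots> = R \<otimes>\<^bsub>H2\<^esub> (R_inv \<otimes>\<^bsub>H2\<^esub> tensor_map s S S \<chi>)"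
    by (intro H2.m_assoc R_closed R_inv_closed tensor_map_closed chi_closed)
  also have "\<dots> = R \<otimes>\<^bsub>H2\<^esub> \<chi> \<otimes>\<^bsub>H2\<^esub> R_inv"
    unfolding R_inv_mult_antipode_chi
    by (intro H2.m_assoc[symmetric] R_closed R_inv_closed chi_closed)
  finally show ?thesis .
qed

text \<open>S \<otimes> S reverses products and fixes \<open>R_inv\<close>. Applied to
  \<open>R_inv_mult_antipode_chi\<close>, it equates the double image of \<chi> times
  \<open>R_inv\<close> with \<open>R_inv\<close> times the single image, which is \<chi> times
  \<open>R_inv\<close> again; then \<open>R_inv\<close> cancels.\<close>

lemma antipode_square_chi: "tensor_map s (S \<circ> S) (S \<circ> S) \<chi> = \<chi>"
proof -
  let ?S = "tensor_map s S S"
  have cancel: "t \<otimes>\<^bsub>H2\<^esub> R_inv \<otimes>\<^bsub>H2\<^esub> R = t" if "t \<in> carrier H2" for t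
    using that by (simp add: H2.m_assoc R_closed R_inv_closed R_invertible)
  have "?S (?S \<chi>) \<otimes>\<^bsub>H2\<^esub> R_inv = ?S (R_inv \<otimes>\<^bsub>H2\<^esub> ?S \<chi>)"
    by (simp add: antipode_tensor_mult antipode_R_inv tensor_map_closed chi_closed R_inv_closed)
  also have "\<dots> = R_inv \<otimes>\<^bsub>H2\<^esub> ?S \<chi>"
    unfolding R_inv_mult_antipode_chi
    by (simp add: antipode_tensor_mult antipode_R_inv chi_closed R_inv_closed
        R_inv_mult_antipode_chi)
  also have "\<dots> = \<chi> \<otimes>\<^bsub>H2\<^esub> R_inv"
    by (rule R_inv_mult_antipode_chi)
  finally have "?S (?S \<chi>) = \<chi>"
    using cancel[of "?S (?S \<chi>)"] cancel[OF chi_closed] by (simp add: tensor_map_closed chi_closed)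
  then show ?thesis
    by (simp add: tensor_map_tensor_map chi_closed linear_op_antipode linear_op_intros)
qed

text \<open>The Cartier condition says that the conjugate of \<chi> by \<open>R\<close> is the flip
  of \<chi>. By \<open>antipode_chi\<close> that conjugate is (S \<otimes> S)(\<chi>), and the flip
  is an involution.\<close>

lemma cartier_iff: "cartier s \<Delta> \<epsilon> S R \<chi> \<longleftrightarrow> flip s (tensor_map s S S \<chi>) = \<chi>"
proof
  assume "cartier s \<Delta> \<epsilon> S R \<chi>"
  then have "R \<otimes>\<^bsub>H2\<^esub> \<chi> = flip s \<chi> \<otimes>\<^bsub>H2\<^esub> R"
    by (rule cartier.R_chi)
  then have "tensor_map s S S \<chi> = flip s \<chi> \<otimes>\<^bsub>H2\<^esub> R \<otimes>\<^bsub>H2\<^esub> R_inv"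
    by (simp add: antipode_chi)
  then show "flip s (tensor_map s S S \<chi>) = \<chi>"
    by (simp add: H2.m_assoc R_closed R_inv_closed R_invertible flip_closed flip_flip chi_closed)
next
  assume "flip s (tensor_map s S S \<chi>) = \<chi>"
  then have "flip s \<chi> = R \<otimes>\<^bsub>H2\<^esub> \<chi> \<otimes>\<^bsub>H2\<^esub> R_inv"
    by (metis antipode_chi flip_flip tensor_map_closed chi_closed)
  then have "R \<otimes>\<^bsub>H2\<^esub> \<chi> = flip s \<chi> \<otimes>\<^bsub>H2\<^esub> R"
    by (simp add: H2.m_assoc R_closed R_inv_closed R_invertible chi_closed)
  then show "cartier s \<Delta> \<epsilon> S R \<chi>"
    by unfold_locales
qed

end

theorem proposition3p4:
  fixes s :: "'k::field \<Rightarrow> 'h::ring_1 \<Rightarrow> 'h"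
    and \<Delta> :: "'h \<Rightarrow> ('k, 'h) tensor"
    and \<epsilon> :: "'h \<Rightarrow> 'k"
    and S :: "'h \<Rightarrow> 'h"
    and R \<chi> :: "('k, 'h) tensor"
  assumes "pre_cartier s \<Delta> \<epsilon> S R \<chi>"
  shows "tensor_map s S S \<chi> =
        R \<otimes>\<^bsub>tensor_power s 2\<^esub> \<chi> \<otimes>\<^bsub>tensor_power s 2\<^esub> inv\<^bsub>tensor_power s 2\<^esub> R
      \<and> tensor_map s (S \<circ> S) (S \<circ> S) \<chi> = \<chi>
      \<and> (cartier s \<Delta> \<epsilon> S R \<chi> \<longleftrightarrow> flip s (tensor_map s S S \<chi>) = \<chi>)"
proof -
  interpret pre_cartier s \<Delta> \<epsilon> S R \<chi> by (rule assms)
  show ?thesis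
    by (intro conjI antipode_chi antipode_square_chi cartier_iff)
qed

end
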